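(* Let $K$ be a field, $S=K[x_1,\ldots,x_n]$, let $0\subset I\subsetneq J\subset S$ be two monomial ideals and let $0\subset I^p\subsetneq J^p\subset S^p$ be their polarizations. Then $$\operatorname{slength}(J/I)\geq \operatorname{slength}(J^p/I^p).$$
   Context: Let $R$ be a polynomial ring over $K$ in $N$ variables and $M$ a finitely generated $\mathbb Z^N$-graded $R$-module. A Stanley decomposition of $M$ is a finite direct sum of $K$-vector spaces $\mathcal D: M=\bigoplus_{i=1}^r m_iK[Z_i]$, where each $m_i\in M$ is homogeneous, $Z_i$ is a subset of the variables of $R$, and $m_iK[Z_i]$ is a free $K[Z_i]$-module. Its length is $\operatorname{slength}(\mathcal D)=r$, and $\operatorname{slength}(M)=\min\{\operatorname{slength}(\mathcal D):\mathcal D\text{ is a Stanley decomposition of }M\}$. The Stanley lengths of $J/I$ and $J^p/I^p$ are taken over $S$ and $S^p$ respectively. Polarization: let $I\subset S$ be a monomial ideal with minimal monomial generators $u_i=\prod_{j=1}^n x_j^{a_{ij}}$, $1\leq i\leq m$. Let $a_j=\max\{a_{ij}:1\leq i\leq m\}$, choose $g=(g_1,\ldots,g_n)\in\mathbb N^n$ with $a_j\leq g_j$ for all $1\leq j\leq n$, and set $S^p=K[x_{jk}:1\leq j\leq n,\,1\leq k\leq g_j]$. The polarization of $I$ is the squarefree monomial ideal $I^p\subset S^p$ generated by $v_i=\prod_{j=1}^n\prod_{k=1}^{a_{ij}}x_{jk}$, $1\leq i\leq m$. For the two ideals $I\subset J$, the same vector $g$, large enough for both ideals, is used, so that $I^p$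 and $J^p$ lie in the same ring $S^p$. *)

theory Defs
  imports "HOL-Library.Poly_Mapping" "HOL-Algebra.QuotRing" "HOL-Algebra.Module"
begin

section \<open>Polynomial rings and monomial ideals\<close>

text \<open>
  A polynomial maps exponent vectors to coefficients; its multiplication on
  \<^typ>\<open>('v \<Rightarrow>\<^sub>0 nat) \<Rightarrow>\<^sub>0 'k\<close> is convolution.  The ring \<open>K[V]\<close> is the subring of those
  polynomials that involve only variables from the set \<open>V\<close>, so rings whose variables
  depend on a parameter (such as \<open>S\<^sup>p\<close> below) need no type of their own.
\<close>

type_synonym 'v expo = "'v \<Rightarrow>\<^sub>0 nat"
type_synonym ('v, 'k) mpol = "'v expo \<Rightarrow>\<^sub>0 'k"

definition expos :: "'v set \<Rightarrow> 'v expo set" where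
  "expos V = {t. Poly_Mapping.keys t \<subseteq> V}"

definition poly_ring :: "'v set \<Rightarrow> ('v, 'k::field) mpol ring" where
  "poly_ring V = \<lparr>carrier = {p. Poly_Mapping.keys p \<subseteq> expos V},
     mult = (*), one = 1, zero = 0, add = (+)\<rparr>"

definition monom_of :: "'v expo \<Rightarrow> ('v, 'k::field) mpol" where
  "monom_of t = Poly_Mapping.single t 1"

definition indet :: "'v \<Rightarrow> ('v, 'k::field) mpol" where
  "indet v = monom_of (Poly_Mapping.single v 1)"

definition monomial_ideal :: "'v set \<Rightarrow> ('v, 'k::field) mpol set \<Rightarrow> bool" where
  "monomial_ideal V I \<longleftrightarrow> (\<exists>A \<subseteq> expos V. I = Idl\<^bsub>poly_ring V\<^esub> (monom_of ` A))"

text \<open>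
  Exponents of the minimal monomial generators: the monomials of \<open>I\<close> not properly divisible by
  another monomial of \<open>I\<close>.  Divisibility is written out because the library order \<open>\<le>\<close> on
  \<^typ>\<open>'v expo\<close> is not the componentwise one.
\<close>

definition min_gens :: "('v, 'k::field) mpol set \<Rightarrow> 'v expo set" where
  "min_gens I = {t. monom_of t \<in> I \<and>
     (\<forall>s. monom_of s \<in> I \<and> (\<forall>v. Poly_Mapping.lookup s v \<le> Poly_Mapping.lookup t v) \<longrightarrow> s = t)}"


section \<open>Polarization\<close>

definition pol_vars :: "nat \<Rightarrow> (nat \<Rightarrow> nat) \<Rightarrow> (nat \<times> nat) set" where
  "pol_vars n g = {(j, k). j \<in> {1..n} \<and> k \<in> {1..g j}}"

definition pol_mono :: "nat \<Rightarrow> nat expo \<Rightarrow> (nat \<times> nat, 'k::field) mpol" where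
  "pol_mono n t = (\<Prod>j = 1..n. \<Prod>k = 1..Poly_Mapping.lookup t j. indet (j, k))"

definition polarization ::
  "nat \<Rightarrow> (nat \<Rightarrow> nat) \<Rightarrow> (nat, 'k::field) mpol set \<Rightarrow> (nat \<times> nat, 'k) mpol set" where
  "polarization n g I = Idl\<^bsub>poly_ring (pol_vars n g)\<^esub> (pol_mono n ` min_gens I)"

definition pol_bound :: "nat \<Rightarrow> (nat \<Rightarrow> nat) \<Rightarrow> (nat, 'k::field) mpol set \<Rightarrow> bool" where
  "pol_bound n g I \<longleftrightarrow> (\<forall>t \<in> min_gens I. \<forall>j \<in> {1..n}. Poly_Mapping.lookup t j \<le> g j)"


section \<open>Multigraded modules and Stanley decompositions\<close>

text \<open>
  A module over \<open>K[V]\<close> together with its homogeneous components.  A degree in \<open>\<int>\<^sup>V\<close> is a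
  function \<^typ>\<open>'v \<Rightarrow> int\<close>; components of degrees not supported in \<open>V\<close> are zero.
\<close>

record ('a, 'v, 'b) graded_module = "('a, 'b) module" +
  component :: "('v \<Rightarrow> int) \<Rightarrow> 'b set"

definition homogeneous :: "('a, 'v, 'b, 'z) graded_module_scheme \<Rightarrow> 'b \<Rightarrow> bool" where
  "homogeneous M m \<longleftrightarrow> (\<exists>d. m \<in> component M d)"

text \<open>
  A basis of a module: every element is a unique finite linear combination; the coefficient
  functions are normalised to be zero outside \<open>B\<close>.
\<close>

definition module_basis ::
  "('a, 'x) ring_scheme \<Rightarrow> ('a, 'b, 'y) module_scheme \<Rightarrow> 'b set \<Rightarrow> bool" where
  "module_basis R M B \<longleftrightarrow> B \<subseteq> carrier M \<and>
     (\<forall>x \<in> carrier M. \<exists>!c. c ` B \<subseteq> carrier R \<and> (\<forall>b. b \<notin> B \<longrightarrow> c b = \<zero>\<^bsub>R\<^esub>) \<and>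
        finite {b. c b \<noteq> \<zero>\<^bsub>R\<^esub>} \<and>
        x = (\<Oplus>\<^bsub>M\<^esub> b \<in> {b. c b \<noteq> \<zero>\<^bsub>R\<^esub>}. c b \<odot>\<^bsub>M\<^esub> b))"

definition free_module :: "('a, 'x) ring_scheme \<Rightarrow> ('a, 'b, 'y) module_scheme \<Rightarrow> bool" where
  "free_module R M \<longleftrightarrow> (\<exists>B. module_basis R M B)"

definition stanley_space ::
  "(('v, 'k::field) mpol, 'b, 'y) module_scheme \<Rightarrow> 'b \<Rightarrow> 'v set \<Rightarrow> 'b set" where
  "stanley_space M m Z = {p \<odot>\<^bsub>M\<^esub> m | p. p \<in> carrier (poly_ring Z)}"

definition internal_direct_sum ::
  "('a, 'b, 'y) module_scheme \<Rightarrow> nat \<Rightarrow> (nat \<Rightarrow> 'b set) \<Rightarrow> bool" where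
  "internal_direct_sum M r W \<longleftrightarrow> (\<forall>i<r. W i \<subseteq> carrier M) \<and>
     (\<forall>x \<in> carrier M. \<exists>!y. y \<in> (\<Pi>\<^sub>E i \<in> {..<r}. W i) \<and> x = (\<Oplus>\<^bsub>M\<^esub> i \<in> {..<r}. y i))"

text \<open>
  The list \<open>[(m\<^sub>1, Z\<^sub>1), \<dots>, (m\<^sub>r, Z\<^sub>r)]\<close> stands for \<open>M = m\<^sub>1 K[Z\<^sub>1] \<oplus> \<dots> \<oplus> m\<^sub>r K[Z\<^sub>r]\<close>.
\<close>

definition stanley_decomposition ::
  "'v set \<Rightarrow> (('v, 'k::field) mpol, 'v, 'b, 'z) graded_module_scheme \<Rightarrow>
   ('b \<times> 'v set) list \<Rightarrow> bool" where
  "stanley_decomposition V M D \<longleftrightarrow>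
     (\<forall>(m, Z) \<in> set D. m \<in> carrier M \<and> homogeneous M m \<and> Z \<subseteq> V \<and>
        free_module (poly_ring Z :: ('v, 'k) mpol ring) (M\<lparr>carrier := stanley_space M m Z\<rparr>)) \<and>
     internal_direct_sum M (length D) (\<lambda>i. stanley_space M (fst (D ! i)) (snd (D ! i)))"

definition slength ::
  "'v set \<Rightarrow> (('v, 'k::field) mpol, 'v, 'b, 'z) graded_module_scheme \<Rightarrow> nat" where
  "slength V M = (LEAST r. \<exists>D. stanley_decomposition V M D \<and> length D = r)"


section \<open>The graded module \<open>J/I\<close>\<close>

text \<open>
  For ideals \<open>I \<subseteq> J\<close> of \<open>K[V]\<close>, the module \<open>J/I\<close> consists of the residue classes of elements
  of \<open>J\<close> in \<open>K[V]/I\<close>, with \<open>K[V]\<close> acting through \<open>K[V]/I\<close>.  The component of degree \<open>d\<close> consists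
  of the classes of those \<open>f \<in> J\<close> all of whose monomials have degree \<open>d\<close>.
\<close>

definition quot_module :: "'v set \<Rightarrow> ('v, 'k::field) mpol set \<Rightarrow> ('v, 'k) mpol set \<Rightarrow>
    (('v, 'k) mpol, 'v, ('v, 'k) mpol set) graded_module" where
  "quot_module V J I = (let R = poly_ring V; Q = R Quot I in
     \<lparr>carrier = (\<lambda>f. I +>\<^bsub>R\<^esub> f) ` J,
      mult = mult Q, one = one Q, zero = zero Q, add = add Q,
      smult = (\<lambda>f x. (I +>\<^bsub>R\<^esub> f) \<otimes>\<^bsub>Q\<^esub> x),
      component = (\<lambda>d. (\<lambda>f. I +>\<^bsub>R\<^esub> f) `
         {f \<in> J. \<forall>t \<in> Poly_Mapping.keys f. \<forall>v. int (Poly_Mapping.lookup t v) = d v})\<rparr>)"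

end

theory Submission
  imports Defs
begin

text \<open>
  A Stanley decomposition of \<open>J/I\<close> is the same as a partition of the set of monomials in
  \<open>J - I\<close> into cones \<open>x\<^sup>t K[Z]\<close>: homogeneous elements of \<open>J/I\<close> are classes of terms, and
  freeness of \<open>m K[Z]\<close> forces the cone of \<open>m\<close> to avoid \<open>I\<close>.  Send an exponent \<open>u\<close> of
  \<open>S\<^sup>p\<close> to the exponent \<open>\<phi>(u)\<close> of \<open>S\<close> (\<open>depol u\<close> below) whose \<open>j\<close>-th entry is the length of
  the initial run of nonzero entries in \<open>u\<^sub>j\<^sub>1, u\<^sub>j\<^sub>2, \<dots>\<close>.  Then \<open>x\<^sup>u \<in> I\<^sup>p\<close> iff
  \<open>x\<^bsup>\<phi>(u)\<^esup> \<in> I\<close>, and \<open>\<phi>\<close> pulls the cone of \<open>(t, Z)\<close> back to the empty set (if \<open>t \<le> g\<close>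
  fails) or to the cone of the polarized monomial \<open>\<Prod>\<^sub>j x\<^sub>j\<^sub>1 \<cdots> x\<^sub>j\<^sub>a\<close>, \<open>a = t\<^sub>j\<close>, in all
  variables except the \<open>x\<^sub>j\<^sub>k\<close> with \<open>j \<notin> Z\<close> and \<open>k = t\<^sub>j + 1\<close>.  So every decomposition of
  \<open>J/I\<close> yields one of \<open>J\<^sup>p/I\<^sup>p\<close> that is not longer.
\<close>

section \<open>Monomial ideals as spans of exponent sets\<close>

text \<open>The ring \<open>K[V]\<close>, its monomial ideals and (by \<open>mspan_cone\<close>) the
  spaces \<open>m K[Z]\<close> for a nonzero term \<open>m\<close> are all spans of this form, so
  questions about them become questions about sets of exponents.\<close>

definition mspan :: "'v expo set \<Rightarrow> ('v, 'k::field) mpol set" where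
  "mspan T = {p. Poly_Mapping.keys p \<subseteq> T}"

text \<open>These are the exponent sets of monomial ideals of \<open>K[V]\<close>; see
  \<open>ideal_mspan\<close> and \<open>Idl_monoms\<close>.\<close>

definition closed_expos :: "'v set \<Rightarrow> 'v expo set \<Rightarrow> bool" where
  "closed_expos V T \<longleftrightarrow> T \<subseteq> expos V \<and> (\<forall>t\<in>T. \<forall>s\<in>expos V. t + s \<in> T)"

text \<open>The exponents of the monomials in \<open>x^t K[Z]\<close>. The entrywise form suits the
  comparison with polarized exponents; \<open>cone_alt\<close> gives the translate of
  \<open>expos Z\<close> that suits multiplication.\<close>

definition cone :: "'v expo \<Rightarrow> 'v set \<Rightarrow> 'v expo set" where
  "cone t Z = {u. (\<forall>v. Poly_Mapping.lookup t v \<le> Poly_Mapping.lookup u v) \<and>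
     (\<forall>v. v \<notin> Z \<longrightarrow> Poly_Mapping.lookup u v = Poly_Mapping.lookup t v)}"

lemma expos_iff: "t \<in> expos V \<longleftrightarrow> (\<forall>v. v \<notin> V \<longrightarrow> Poly_Mapping.lookup t v = 0)"
  by (auto simp: expos_def in_keys_iff)

lemma expos_zero [simp]: "0 \<in> expos V"
  by (simp add: expos_def)

lemma expos_add: "s \<in> expos V \<Longrightarrow> t \<in> expos V \<Longrightarrow> s + t \<in> expos V"
  by (simp add: expos_iff lookup_add)

lemma expos_mono: "Z \<subseteq> V \<Longrightarrow> expos Z \<subseteq> expos V"
  by (auto simp: expos_def)

lemma add_diff_expo:
  fixes t u :: "'v expo"
  assumes "\<And>v. Poly_Mapping.lookup t v \<le> Poly_Mapping.lookup u v"
  shows "t + (u - t) = u"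
  by (rule poly_mapping_eqI) (simp add: lookup_add lookup_minus assms)

lemma cone_alt: "cone t Z = (+) t ` expos Z"
proof (intro equalityI subsetI)
  fix u assume u: "u \<in> cone t Z"
  then have "u = t + (u - t)"
    by (simp add: cone_def add_diff_expo)
  moreover have "u - t \<in> expos Z"
    using u by (simp add: cone_def expos_iff lookup_minus)
  ultimately show "u \<in> (+) t ` expos Z" by blast
next
  fix u assume "u \<in> (+) t ` expos Z"
  then show "u \<in> cone t Z"
    by (auto simp: cone_def expos_iff lookup_add)
qed

lemma cone_self: "t \<in> cone t Z"
  by (simp add: cone_def)

lemma cone_subset_expos: "t \<in> expos V \<Longrightarrow> Z \<subseteq> V \<Longrightarrow> cone t Z \<subseteq> expos V"
  unfolding cone_alt using expos_mono[of Z V] by (auto intro!: expos_add)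

lemma lookup_mspan: "p \<in> mspan T \<Longrightarrow> u \<notin> T \<Longrightarrow> Poly_Mapping.lookup p u = 0"
  by (auto simp: mspan_def in_keys_iff)

lemma mspan_0 [simp]: "0 \<in> mspan T"
  by (simp add: mspan_def)

lemma mspan_add: "p \<in> mspan T \<Longrightarrow> q \<in> mspan T \<Longrightarrow> p + q \<in> mspan T"
  using keys_add[of p q] by (auto simp: mspan_def)

lemma mspan_diff: "p \<in> mspan T \<Longrightarrow> q \<in> mspan T \<Longrightarrow> p - q \<in> mspan T"
  using keys_diff[of p q] by (auto simp: mspan_def)

lemma mspan_uminus: "p \<in> mspan T \<Longrightarrow> - p \<in> mspan T"
  by (simp add: mspan_def)

lemma mspan_sum: "(\<And>i. i \<in> A \<Longrightarrow> f i \<in> mspan T) \<Longrightarrow> sum f A \<in> mspan T"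
  by (induction A rule: infinite_finite_induct) (auto intro: mspan_add)

lemma mspan_single: "t \<in> T \<Longrightarrow> Poly_Mapping.single t c \<in> mspan T"
  by (simp add: mspan_def)

lemma monom_of_mspan: "monom_of t \<in> (mspan T :: ('v, 'k::field) mpol set) \<longleftrightarrow> t \<in> T"
  by (simp add: mspan_def monom_of_def)

lemma mspan_mono: "S \<subseteq> T \<Longrightarrow> mspan S \<subseteq> mspan T"
  by (auto simp: mspan_def)

lemma mspan_mult: 
  assumes "closed_expos V T" "p \<in> mspan (expos V)" "q \<in> mspan T"
  shows "p * q \<in> mspan T"
proof -
  have "a + b \<in> T" if "a \<in> Poly_Mapping.keys p" "b \<in> Poly_Mapping.keys q" for a b
  proof -
    from assms(2,3) that have "a \<in> expos V" "b \<in> T"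
      unfolding mspan_def by blast+
    with assms(1) have "b + a \<in> T"
      by (simp add: closed_expos_def)
    then show ?thesis by (simp add: add.commute)
  qed
  then show ?thesis
    using keys_mult[of p q] by (auto simp: mspan_def)
qed

lemma closed_expos_expos: "closed_expos V (expos V)"
  by (simp add: closed_expos_def expos_add)

lemma closed_expos_up: "A \<subseteq> expos V \<Longrightarrow> closed_expos V (\<Union>a\<in>A. cone a V)"
  unfolding cone_alt closed_expos_def
  by (auto intro: expos_add simp: add.assoc intro!: image_eqI)

lemma poly_mapping_sum_singles:
  fixes p :: "'a \<Rightarrow>\<^sub>0 'b::comm_monoid_add"
  shows "p = (\<Sum>t\<in>Poly_Mapping.keys p. Poly_Mapping.single t (Poly_Mapping.lookup p t))"
  by (rule poly_mapping_eqI)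
    (auto simp: lookup_sum lookup_single when_def in_keys_iff sum.delta sum.delta')

lemma lookup_mult_single:
  fixes p :: "('v, 'k::field) mpol"
  shows "Poly_Mapping.lookup (p * Poly_Mapping.single t c) (t + s) = Poly_Mapping.lookup p s * c"
proof -
  have "p * Poly_Mapping.single t c =
    (\<Sum>u\<in>Poly_Mapping.keys p. Poly_Mapping.single (u + t) (Poly_Mapping.lookup p u * c))"
    by (subst (1) poly_mapping_sum_singles[of p]) (simp add: sum_distrib_right mult_single)
  then show ?thesis
    by (auto simp: lookup_sum lookup_single when_def in_keys_iff add.commute[of _ t] sum.delta sum.delta')
qed

lemma mult_single_right_cancel:
  fixes p q :: "('v, 'k::field) mpol"
  assumes "p * Poly_Mapping.single t c = q * Poly_Mapping.single t c" "c \<noteq> 0"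
  shows "p = q"
  using assms by (metis lookup_mult_single mult_right_cancel poly_mapping_eqI)

text \<open>Multiplication by the term \<open>c x^t\<close> is undone by dividing every term, which
  needs only \<open>c\<close> to be a unit. The scalar of a homogeneous generator therefore leaves
  no trace in its Stanley space.\<close>

lemma mspan_cone:
  fixes t :: "'v expo" and c :: "'k::field"
  assumes "c \<noteq> 0"
  shows "mspan (cone t Z) = (\<lambda>p. p * Poly_Mapping.single t c) ` mspan (expos Z)"
proof (intro equalityI subsetI)
  fix h :: "('v, 'k) mpol" assume h: "h \<in> mspan (cone t Z)"
  \<comment> \<open>The termwise quotient of \<open>h\<close> by \<open>c x^t\<close>; the truncated
    subtraction \<open>u - t\<close> is exact on the cone.\<close>
  let ?p = "\<Sum>u\<in>Poly_Mapping.keys h. Poly_Mapping.single (u - t) (Poly_Mapping.lookup h u / c)"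
  have u: "u - t \<in> expos Z \<and> u - t + t = u" if "u \<in> Poly_Mapping.keys h" for u
  proof -
    from h that obtain s where "u = t + s" "s \<in> expos Z"
      by (auto simp: mspan_def cone_alt)
    then show ?thesis by (simp add: add.commute)
  qed
  have "?p * Poly_Mapping.single t c =
    (\<Sum>u\<in>Poly_Mapping.keys h. Poly_Mapping.single (u - t + t) (Poly_Mapping.lookup h u))"
    using assms by (simp add: sum_distrib_right mult_single)
  also have "\<dots> = (\<Sum>u\<in>Poly_Mapping.keys h. Poly_Mapping.single u (Poly_Mapping.lookup h u))"
    by (rule sum.cong) (simp_all add: u)
  also have "\<dots> = h"
    by (rule poly_mapping_sum_singles[symmetric])
  finally have "?p * Poly_Mapping.single t c = h" .
  moreover have "?p \<in> mspan (expos Z)"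
    using u by (intro mspan_sum mspan_single) simp
  ultimately show "h \<in> (\<lambda>p. p * Poly_Mapping.single t c) ` mspan (expos Z)"
    by (rule image_eqI[OF sym])
next
  fix h :: "('v, 'k) mpol" assume "h \<in> (\<lambda>p. p * Poly_Mapping.single t c) ` mspan (expos Z)"
  then obtain p where p: "h = p * Poly_Mapping.single t c" "p \<in> mspan (expos Z)" by blast
  moreover have "{a + b |a b. a \<in> Poly_Mapping.keys p \<and> b \<in> Poly_Mapping.keys (Poly_Mapping.single t c)} \<subseteq> cone t Z"
    using p(2) assms by (auto simp: mspan_def cone_alt add.commute[of _ t])
  ultimately show "h \<in> mspan (cone t Z)"
    using keys_mult[of p "Poly_Mapping.single t c"] by (auto simp: mspan_def)
qed

section \<open>Polynomial rings and monomial ideals as algebraic structures\<close>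

lemma carrier_poly_ring [simp]: "carrier (poly_ring V) = mspan (expos V)"
  and mult_poly_ring [simp]: "mult (poly_ring V) = (*)"
  and one_poly_ring [simp]: "\<one>\<^bsub>poly_ring V\<^esub> = 1"
  and zero_poly_ring [simp]: "\<zero>\<^bsub>poly_ring V\<^esub> = 0"
  and add_poly_ring [simp]: "add (poly_ring V) = (+)"
  by (auto simp: poly_ring_def mspan_def)

lemma cring_poly_ring: "cring (poly_ring V :: ('v, 'k::field) mpol ring)"
proof (rule cringI)
  show "abelian_group (poly_ring V :: ('v, 'k) mpol ring)"
    by (rule abelian_groupI)
      (auto simp: mspan_add add.assoc intro: add.commute bexI[of _ "- x" for x] mspan_uminus)
  show "comm_monoid (poly_ring V :: ('v, 'k) mpol ring)"
  proof (rule comm_monoidI, goal_cases)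
    case 1 then show ?case by (simp add: mspan_mult[OF closed_expos_expos])
  next
    case 2 then show ?case by (simp add: mspan_def)
  next
    case 3 then show ?case by (simp add: mult.assoc)
  next
    case 4 then show ?case by simp
  next
    case 5 then show ?case by (simp add: mult.commute)
  qed
qed (simp add: distrib_right)

lemma a_inv_poly_ring:
  fixes p :: "('v, 'k::field) mpol"
  assumes "p \<in> mspan (expos V)"
  shows "\<ominus>\<^bsub>poly_ring V\<^esub> p = - p"
proof -
  interpret cring "poly_ring V :: ('v, 'k) mpol ring" by (rule cring_poly_ring)
  show ?thesis
    by (rule sum_zero_eq_neg[symmetric]) (simp_all add: assms mspan_uminus)
qed

lemma ideal_mspan:
  assumes "closed_expos V T"
  shows "ideal (mspan T :: ('v, 'k::field) mpol set) (poly_ring V)"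
proof -
  interpret cring "poly_ring V :: ('v, 'k) mpol ring" by (rule cring_poly_ring)
  have sub: "(mspan T :: ('v, 'k) mpol set) \<subseteq> mspan (expos V)"
    using assms mspan_mono by (auto simp: closed_expos_def)
  show ?thesis
  proof (rule idealI)
    show "ring (poly_ring V :: ('v, 'k) mpol ring)" by (rule ring_axioms)
    show "subgroup (mspan T :: ('v, 'k) mpol set) (add_monoid (poly_ring V))"
    proof (rule add.subgroupI)
      fix p :: "('v, 'k) mpol" assume "p \<in> mspan T"
      then show "\<ominus>\<^bsub>poly_ring V\<^esub> p \<in> mspan T"
        using subsetD[OF sub, of p] by (simp add: mspan_uminus a_inv_poly_ring)
    qed (use sub in \<open>auto intro: mspan_add mspan_0\<close>)
  next
    fix p q :: "('v, 'k) mpol" assume "p \<in> mspan T" "q \<in> carrier (poly_ring V)"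
    then have "q * p \<in> mspan T" by (simp add: mspan_mult[OF assms])
    then show "q \<otimes>\<^bsub>poly_ring V\<^esub> p \<in> mspan T" "p \<otimes>\<^bsub>poly_ring V\<^esub> q \<in> mspan T"
      by (simp_all add: mult.commute)
  qed
qed

text \<open>The span is an ideal containing the generators, which gives one inclusion by minimality.
  Conversely, each term of an element of the span is a multiple of some generator, and an ideal
  contains the finite sum of these terms.\<close>

lemma Idl_monoms:
  assumes "A \<subseteq> expos V"
  shows "Idl\<^bsub>poly_ring V\<^esub> (monom_of ` A) = (mspan (\<Union>a\<in>A. cone a V) :: ('v, 'k::field) mpol set)"
proof -
  interpret cring "poly_ring V :: ('v, 'k) mpol ring" by (rule cring_poly_ring)
  let ?G = "monom_of ` A :: ('v, 'k) mpol set"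
  have G: "?G \<subseteq> mspan (expos V)"
    using assms by (auto simp: monom_of_mspan)
  interpret I: ideal "Idl\<^bsub>poly_ring V\<^esub> ?G" "poly_ring V"
    by (rule genideal_ideal) (use G in simp)
  show ?thesis
  proof
    show "Idl\<^bsub>poly_ring V\<^esub> ?G \<subseteq> mspan (\<Union>a\<in>A. cone a V)"
      by (rule genideal_minimal[OF ideal_mspan[OF closed_expos_up[OF assms]]])
        (simp add: image_subset_iff monom_of_mspan, blast intro: cone_self)
    show "mspan (\<Union>a\<in>A. cone a V) \<subseteq> Idl\<^bsub>poly_ring V\<^esub> ?G"
    proof
      fix p :: "('v, 'k) mpol" assume p: "p \<in> mspan (\<Union>a\<in>A. cone a V)"
      have single: "Poly_Mapping.single u c \<in> Idl\<^bsub>poly_ring V\<^esub> ?G" if "u \<in> Poly_Mapping.keys p" for u and c :: 'k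
      proof -
        from p that have "u \<in> (\<Union>a\<in>A. cone a V)"
          unfolding mspan_def by blast
        then obtain a s where "a \<in> A" "s \<in> expos V" "u = a + s"
          by (auto simp: cone_alt)
        then have "monom_of a \<in> Idl\<^bsub>poly_ring V\<^esub> ?G"
          and "Poly_Mapping.single u c = Poly_Mapping.single s c * (monom_of a :: ('v, 'k) mpol)"
          and "(Poly_Mapping.single s c :: ('v, 'k) mpol) \<in> mspan (expos V)"
          using genideal_self[of ?G] G 
          by (auto simp: monom_of_def mult_single add.commute mspan_single)
        then show ?thesis
          using I.I_l_closed[of "monom_of a" "Poly_Mapping.single s c"] by simp
      qed
      have "(\<Sum>u\<in>B. Poly_Mapping.single u (Poly_Mapping.lookup p u)) \<in> Idl\<^bsub>poly_ring V\<^esub> ?G"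
        if "B \<subseteq> Poly_Mapping.keys p" for B
        using finite_subset[OF that finite_keys] that
      proof (induction B)
        case empty
        then show ?case using I.zero_closed by simp
      next
        case (insert u B)
        then show ?case using I.a_closed[OF single] by simp
      qed
      then show "p \<in> Idl\<^bsub>poly_ring V\<^esub> ?G"
        using poly_mapping_sum_singles[of p] by (metis order_refl)
    qed
  qed
qed

section \<open>Stanley decompositions as partitions into cones\<close>

text \<open>The combinatorial counterpart of a Stanley decomposition of the quotient whose nonzero
  monomial classes have exponents in \<open>A\<close>; its length is \<open>card E\<close>.\<close>

definition cone_partition :: "'v set \<Rightarrow> 'v expo set \<Rightarrow> ('v expo \<times> 'v set) set \<Rightarrow> bool" where
  "cone_partition V A E \<longleftrightarrow> finite E \<and>
     (\<forall>(t, Z)\<in>E. Z \<subseteq> V \<and> cone t Z \<subseteq> A) \<and>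
     (\<forall>u\<in>A. \<exists>!e. e \<in> E \<and> u \<in> cone (fst e) (snd e))"

lemma internal_direct_sum_cong:
  assumes "\<And>i. i < r \<Longrightarrow> W i = W' i"
  shows "internal_direct_sum M r W \<longleftrightarrow> internal_direct_sum M r W'"
proof -
  have "(\<Pi>\<^sub>E i \<in> {..<r}. W i) = (\<Pi>\<^sub>E i \<in> {..<r}. W' i)"
    by (rule PiE_cong) (simp add: assms)
  then show ?thesis
    using assms by (simp add: internal_direct_sum_def)
qed

text \<open>The ring variables and both exponent sets are parameters, so that one development serves
  \<open>J/I\<close> over \<open>S\<close> and the polarized quotient over its own ring.\<close>

locale monomial_quotient =
  fixes V :: "'v set" and TI TJ :: "'v expo set" and I J :: "('v, 'k::field) mpol set"
  assumes closed_I: "closed_expos V TI" and closed_J: "closed_expos V TJ"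
    and I_eq: "I = mspan TI" and J_eq: "J = mspan TJ"
begin

abbreviation M :: "(('v, 'k) mpol, 'v, ('v, 'k) mpol set) graded_module" where
  "M \<equiv> quot_module V J I"

section \<open>Residue classes and their finite sums\<close>

definition cls :: "('v, 'k) mpol \<Rightarrow> ('v, 'k) mpol set" where
  "cls f = I +>\<^bsub>poly_ring V\<^esub> f"

lemma I_iff: "f \<in> I \<longleftrightarrow> f \<in> mspan TI" and J_iff: "f \<in> J \<longleftrightarrow> f \<in> mspan TJ"
  by (simp_all add: I_eq J_eq)

lemma TJ_sub: "TJ \<subseteq> expos V"
  using closed_J by (simp add: closed_expos_def)

lemma J_sub: "J \<subseteq> mspan (expos V)"
  by (simp add: J_eq mspan_mono TJ_sub)

lemma ideal_I: "ideal I (poly_ring V)"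
  unfolding I_eq by (rule ideal_mspan[OF closed_I])

lemma cls_eq_iff:
  assumes "f \<in> mspan (expos V)" "h \<in> mspan (expos V)"
  shows "cls f = cls h \<longleftrightarrow> f - h \<in> I"
proof -
  interpret cring "poly_ring V :: ('v, 'k) mpol ring" by (rule cring_poly_ring)
  show ?thesis
    using quotient_eq_iff_same_a_r_cos[OF ideal_I, of f h] assms
    by (simp add: cls_def a_minus_def a_inv_poly_ring)
qed

lemma cls_zero: "cls 0 = I"
proof -
  interpret cring "poly_ring V :: ('v, 'k) mpol ring" by (rule cring_poly_ring)
  show ?thesis
    using a_rcos_zero[OF ideal_I, of 0] by (simp add: cls_def I_iff)
qed

lemma carrier_M: "carrier M = cls ` J"
  by (simp add: quot_module_def Let_def cls_def)

lemma zero_M: "\<zero>\<^bsub>M\<^esub> = cls 0"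
  by (simp add: quot_module_def Let_def cls_zero FactRing_def)

lemma add_M:
  assumes "f \<in> mspan (expos V)" "h \<in> mspan (expos V)"
  shows "cls f \<oplus>\<^bsub>M\<^esub> cls h = cls (f + h)"
  using ideal.a_rcos_sum[OF ideal_I, of f h] assms
  by (simp add: quot_module_def Let_def FactRing_def cls_def)

lemma smult_M:
  assumes "f \<in> mspan (expos V)" "h \<in> mspan (expos V)"
  shows "f \<odot>\<^bsub>M\<^esub> cls h = cls (f * h)"
  using ideal.rcoset_mult_add[OF ideal_I, of f h] assms
  by (simp add: quot_module_def Let_def FactRing_def cls_def)

lemma component_M:
  "component M d = cls ` {f \<in> J. \<forall>t \<in> Poly_Mapping.keys f. \<forall>v. int (Poly_Mapping.lookup t v) = d v}"
  by (simp add: quot_module_def Let_def cls_def)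

text \<open>
  Stated for every structure with the operations of \<open>M\<close>, because the modules
  \<open>m K[Z]\<close> are \<open>M\<close> with a smaller carrier, on which \<^const>\<open>finsum\<close> depends.
\<close>

context
  fixes N :: "(('v, 'k) mpol set, 'z) ring_scheme" and F :: "('v, 'k) mpol set"
  assumes carrier_N: "carrier N = cls ` F" and add_N: "add N = add M" and zero_N: "zero N = zero M"
    and F_sub: "F \<subseteq> mspan (expos V)" and F_0: "0 \<in> F"
    and F_add: "\<And>f h. f \<in> F \<Longrightarrow> h \<in> F \<Longrightarrow> f + h \<in> F"
begin

lemma abelian_monoid_cls: "abelian_monoid N"
proof (rule abelian_monoidI)
  fix x y assume "x \<in> carrier N" "y \<in> carrier N"
  then show "x \<oplus>\<^bsub>N\<^esub> y \<in> carrier N" "x \<oplus>\<^bsub>N\<^esub> y = y \<oplus>\<^bsub>N\<^esub> x"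
    using F_sub by (auto simp: carrier_N add_N add_M subset_iff F_add add.commute)
next
  fix x y z assume "x \<in> carrier N" "y \<in> carrier N" "z \<in> carrier N"
  then show "x \<oplus>\<^bsub>N\<^esub> y \<oplus>\<^bsub>N\<^esub> z = x \<oplus>\<^bsub>N\<^esub> (y \<oplus>\<^bsub>N\<^esub> z)"
    using F_sub by (auto simp: carrier_N add_N add_M subset_iff mspan_add add.assoc)
next
  show "\<zero>\<^bsub>N\<^esub> \<in> carrier N"
    using F_0 by (simp add: carrier_N zero_N zero_M)
next
  fix x assume "x \<in> carrier N"
  then show "\<zero>\<^bsub>N\<^esub> \<oplus>\<^bsub>N\<^esub> x = x"
    using F_sub by (auto simp: carrier_N add_N zero_N zero_M add_M subset_iff)
qed

text \<open>Finite sums are computed on representatives. Closure of \<open>F\<close> under addition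
  keeps each partial sum inside the carrier of \<open>N\<close>.\<close>

lemma finsum_cls:
  assumes "finite A" "\<And>i. i \<in> A \<Longrightarrow> f i \<in> F" "\<And>i. i \<in> A \<Longrightarrow> y i = cls (f i)"
  shows "finsum N y A = cls (sum f A)"
proof -
  interpret abelian_monoid N by (rule abelian_monoid_cls)
  have F_sum: "sum f B \<in> F" if "\<And>i. i \<in> B \<Longrightarrow> f i \<in> F" for B
    using that by (induction B rule: infinite_finite_induct) (auto intro: F_add F_0)
  show ?thesis
    using assms
  proof (induction A)
    case empty
    then show ?case by (simp add: zero_N zero_M)
  next
    case (insert i A)
    have "finsum N y (insert i A) = y i \<oplus>\<^bsub>N\<^esub> finsum N y A"
      using insert by (intro finsum_insert) (auto simp: carrier_N)
    also have "\<dots> = cls (f i) \<oplus>\<^bsub>M\<^esub> cls (sum f A)"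
      using insert by (simp add: add_N)
    also have "\<dots> = cls (f i + sum f A)"
      using insert F_sub F_sum[of A] by (intro add_M) auto
    finally show ?case using insert by simp
  qed
qed

end

lemma finsum_M:
  assumes "finite A" "\<And>i. i \<in> A \<Longrightarrow> f i \<in> J" "\<And>i. i \<in> A \<Longrightarrow> y i = cls (f i)"
  shows "finsum M y A = cls (sum f A)"
  by (rule finsum_cls[where F = J]) (use assms J_sub in \<open>auto simp: carrier_M J_iff mspan_add\<close>)

lemma smult_cls_single:
  assumes "t \<in> TJ" "Z \<subseteq> V" "p \<in> mspan (expos Z)"
  shows "p \<odot>\<^bsub>M\<^esub> cls (Poly_Mapping.single t c) = cls (p * Poly_Mapping.single t c)"
  using assms TJ_sub mspan_mono[OF expos_mono[of Z V]]
  by (intro smult_M mspan_single) auto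

section \<open>Stanley spaces and freeness\<close>

lemma stanley_space_single:
  assumes "t \<in> TJ" "Z \<subseteq> V"
  shows "stanley_space M (cls (Poly_Mapping.single t c)) Z =
    cls ` (\<lambda>p. p * Poly_Mapping.single t c) ` mspan (expos Z)"
  using smult_cls_single[OF assms] by (auto simp: stanley_space_def image_iff)

lemma stanley_space_cone:
  assumes "t \<in> TJ" "Z \<subseteq> V" "c \<noteq> 0"
  shows "stanley_space M (cls (Poly_Mapping.single t c)) Z = cls ` mspan (cone t Z)"
  using assms by (simp add: stanley_space_single mspan_cone)

lemma cone_sub_TJ: "t \<in> TJ \<Longrightarrow> Z \<subseteq> V \<Longrightarrow> cone t Z \<subseteq> TJ"
  using closed_J expos_mono[of Z V] by (auto simp: cone_alt closed_expos_def)

lemma finsum_stanley_space: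
  assumes "t \<in> TJ" "Z \<subseteq> V" "c \<noteq> 0" "finite A"
    and "\<And>i. i \<in> A \<Longrightarrow> f i \<in> mspan (cone t Z)" "\<And>i. i \<in> A \<Longrightarrow> y i = cls (f i)"
  shows "finsum (M\<lparr>carrier := stanley_space M (cls (Poly_Mapping.single t c)) Z\<rparr>) y A = cls (sum f A)"
proof (rule finsum_cls[where F = "mspan (cone t Z)"])
  show "mspan (cone t Z) \<subseteq> mspan (expos V)"
    using assms TJ_sub by (intro mspan_mono cone_subset_expos) auto
qed (use assms in \<open>auto simp: stanley_space_cone mspan_add\<close>)

text \<open>The difference of two such representatives is supported both in \<open>C\<close> and in
  \<open>TI\<close>, hence has no terms.\<close>

lemma cls_inj_on:
  assumes "C \<inter> TI = {}" "C \<subseteq> expos V" "f \<in> mspan C" "h \<in> mspan C" "cls f = cls h"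
  shows "f = h"
proof -
  have "f \<in> mspan (expos V)" "h \<in> mspan (expos V)"
    using assms mspan_mono by blast+
  then have "f - h \<in> mspan TI"
    using assms(5) by (simp add: cls_eq_iff I_iff)
  moreover have "f - h \<in> mspan C"
    using assms by (intro mspan_diff)
  ultimately have "Poly_Mapping.keys (f - h) = {}"
    using assms(1) unfolding mspan_def by blast
  then show ?thesis by simp
qed

text \<open>The class of \<open>x^t\<close> alone is a basis. Its coefficient is unique because
  \<open>cls\<close> is injective on the span of the cone, by \<open>dis\<close>, and because
  \<open>x^t\<close> can be cancelled in the polynomial ring.\<close>

lemma free_stanley_space:
  assumes t: "t \<in> TJ" and Z: "Z \<subseteq> V" and dis: "cone t Z \<inter> TI = {}"
  shows "free_module (poly_ring Z) (M\<lparr>carrier := stanley_space M (cls (Poly_Mapping.single t 1)) Z\<rparr>)"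
proof -
  let ?s = "Poly_Mapping.single t 1 :: ('v, 'k) mpol"
  let ?m = "cls ?s"
  let ?N = "M\<lparr>carrier := stanley_space M ?m Z\<rparr>"
  have cone: "p * ?s \<in> mspan (cone t Z)" if "p \<in> mspan (expos Z)" for p
    using that mspan_cone[of 1 t Z] by auto
  have sum: "(\<Oplus>\<^bsub>?N\<^esub> b \<in> {b. c b \<noteq> 0}. c b \<odot>\<^bsub>?N\<^esub> b) = cls (c ?m * ?s)"
    if "c ` {?m} \<subseteq> mspan (expos Z)" "\<And>b. b \<notin> {?m} \<Longrightarrow> c b = 0" for c
  proof -
    \<comment> \<open>The sum in \<open>module_basis\<close> ranges over nonzero coefficients only,
      so a zero coefficient at \<open>?m\<close> gives the empty sum, which still agrees with
      \<open>c ?m * ?s\<close>.\<close>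
    have eq: "{b. c b \<noteq> 0} \<subseteq> {?m}" "{b. c b \<noteq> 0} = (if c ?m = 0 then {} else {?m})"
      using that(2) by (auto, metis)
    have "(\<Oplus>\<^bsub>?N\<^esub> b \<in> {b. c b \<noteq> 0}. c b \<odot>\<^bsub>?N\<^esub> b) = cls (\<Sum>b\<in>{b. c b \<noteq> 0}. c ?m * ?s)"
    proof (rule finsum_stanley_space[OF t Z])
      show "finite {b. c b \<noteq> 0}" using finite_subset[OF eq(1)] by simp
      fix b assume "b \<in> {b. c b \<noteq> 0}"
      then have "b = ?m" using eq(1) by auto
      then show "c b \<odot>\<^bsub>?N\<^esub> b = cls (c ?m * ?s)"
        using that(1) smult_cls_single[OF t Z, of "c ?m" 1] by simp
    qed (use that(1) in \<open>auto intro: cone\<close>)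
    also have "(\<Sum>b\<in>{b. c b \<noteq> 0}. c ?m * ?s) = c ?m * ?s"
      unfolding eq(2) by auto
    finally show ?thesis .
  qed
  have "module_basis (poly_ring Z) ?N {?m}"
    unfolding module_basis_def
  proof (intro conjI ballI)
    have "?m = cls (1 * ?s)" "(1 :: ('v, 'k) mpol) \<in> mspan (expos Z)"
      by (simp_all add: mspan_def)
    then show "{?m} \<subseteq> carrier ?N"
      unfolding stanley_space_single[OF t Z] by (simp, blast)
  next
    fix x assume "x \<in> carrier ?N"
    then obtain p where p: "p \<in> mspan (expos Z)" "x = cls (p * ?s)"
      by (auto simp: stanley_space_single[OF t Z])
    let ?c = "\<lambda>b. if b = ?m then p else 0"
    show "\<exists>!c. c ` {?m} \<subseteq> carrier (poly_ring Z) \<and> (\<forall>b. b \<notin> {?m} \<longrightarrow> c b = \<zero>\<^bsub>poly_ring Z\<^esub>) \<and>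
        finite {b. c b \<noteq> \<zero>\<^bsub>poly_ring Z\<^esub>} \<and>
        x = (\<Oplus>\<^bsub>?N\<^esub> b \<in> {b. c b \<noteq> \<zero>\<^bsub>poly_ring Z\<^esub>}. c b \<odot>\<^bsub>?N\<^esub> b)"
    proof (rule ex1I[of _ ?c])
      show "?c ` {?m} \<subseteq> carrier (poly_ring Z) \<and> (\<forall>b. b \<notin> {?m} \<longrightarrow> ?c b = \<zero>\<^bsub>poly_ring Z\<^esub>) \<and>
        finite {b. ?c b \<noteq> \<zero>\<^bsub>poly_ring Z\<^esub>} \<and>
        x = (\<Oplus>\<^bsub>?N\<^esub> b \<in> {b. ?c b \<noteq> \<zero>\<^bsub>poly_ring Z\<^esub>}. ?c b \<odot>\<^bsub>?N\<^esub> b)"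
        using sum[of ?c] p by simp
    next
      fix c assume c: "c ` {?m} \<subseteq> carrier (poly_ring Z) \<and> (\<forall>b. b \<notin> {?m} \<longrightarrow> c b = \<zero>\<^bsub>poly_ring Z\<^esub>) \<and>
        finite {b. c b \<noteq> \<zero>\<^bsub>poly_ring Z\<^esub>} \<and>
        x = (\<Oplus>\<^bsub>?N\<^esub> b \<in> {b. c b \<noteq> \<zero>\<^bsub>poly_ring Z\<^esub>}. c b \<odot>\<^bsub>?N\<^esub> b)"
      then have "cls (c ?m * ?s) = cls (p * ?s)"
        using sum[of c] p by simp
      then have "c ?m * ?s = p * ?s"
        using c p(1) cone_sub_TJ[OF t Z] TJ_sub
        by (intro cls_inj_on[OF dis]) (auto intro: cone)
      then have "c ?m = p"
        by (rule mult_single_right_cancel) simp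
      then show "c = ?c"
        using c by auto
    qed
  qed
  then show ?thesis
    unfolding free_module_def by blast
qed

text \<open>
  If \<open>x\<^sup>t x\<^sup>s \<in> I\<close> with \<open>x\<^sup>s \<in> K[Z]\<close>, then \<open>x\<^sup>s\<close> annihilates the whole module, in particular
  a basis element.
\<close>

lemma free_stanley_space_disjoint:
  assumes t: "t \<in> TJ" and Z: "Z \<subseteq> V" and c: "c \<noteq> 0"
    and free: "free_module (poly_ring Z) (M\<lparr>carrier := stanley_space M (cls (Poly_Mapping.single t c)) Z\<rparr>)"
    and nz: "cls (Poly_Mapping.single t c) \<noteq> cls 0"
  shows "cone t Z \<inter> TI = {}"
proof (rule ccontr)
  let ?m = "cls (Poly_Mapping.single t c)"
  let ?N = "M\<lparr>carrier := stanley_space M ?m Z\<rparr>"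
  assume "cone t Z \<inter> TI \<noteq> {}"
  then obtain s where s: "s \<in> expos Z" "t + s \<in> TI"
    by (auto simp: cone_alt)
  let ?s = "Poly_Mapping.single s 1 :: ('v, 'k) mpol"
  have s_Z: "?s \<in> mspan (expos Z)"
    using s by (simp add: mspan_single)
  have ZV: "mspan (expos Z) \<subseteq> (mspan (expos V) :: ('v, 'k) mpol set)"
    by (rule mspan_mono[OF expos_mono[OF Z]])
  have t_V: "Poly_Mapping.single t c \<in> mspan (expos V)"
    using t TJ_sub by (auto intro: mspan_single)
  have ann: "?s \<odot>\<^bsub>M\<^esub> x = cls 0" if "x \<in> stanley_space M ?m Z" for x
  proof -
    from that obtain p where p: "p \<in> mspan (expos Z)" "x = cls (p * Poly_Mapping.single t c)"
      by (auto simp: stanley_space_single[OF t Z])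
    have pt: "p * Poly_Mapping.single t c \<in> mspan (expos V)"
      using p ZV t_V by (intro mspan_mult[OF closed_expos_expos]) auto
    have "?s * (p * Poly_Mapping.single t c) = p * Poly_Mapping.single (t + s) c"
      by (simp add: mult.left_commute mult_single add.commute)
    also have "\<dots> \<in> mspan TI"
      using p(1) ZV s by (intro mspan_mult[OF closed_I] mspan_single) auto
    finally have "?s * (p * Poly_Mapping.single t c) - 0 \<in> I"
      by (simp add: I_iff)
    moreover have "?s \<in> mspan (expos V)" using s_Z ZV by blast
    ultimately show ?thesis
      using pt by (simp add: p(2) smult_M cls_eq_iff mspan_mult[OF closed_expos_expos])
  qed
  obtain B where B: "module_basis (poly_ring Z) ?N B"
    using free by (auto simp: free_module_def)
  define P where "P x a \<longleftrightarrow> a ` B \<subseteq> mspan (expos Z) \<and> (\<forall>b. b \<notin> B \<longrightarrow> a b = 0) \<and>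
      finite {b. a b \<noteq> 0} \<and> x = (\<Oplus>\<^bsub>?N\<^esub> b \<in> {b. a b \<noteq> 0}. a b \<odot>\<^bsub>M\<^esub> b)" for x and a :: "_ \<Rightarrow> ('v, 'k) mpol"
  have B_sub: "B \<subseteq> stanley_space M ?m Z" and ex1: "\<And>x. x \<in> stanley_space M ?m Z \<Longrightarrow> \<exists>!a. P x a"
    using B by (simp_all add: module_basis_def P_def)
  have m: "?m \<in> stanley_space M ?m Z" and z: "cls 0 \<in> stanley_space M ?m Z"
    using c by (auto simp: stanley_space_cone[OF t Z] intro!: imageI mspan_single cone_self)
  have sum0: "(\<Oplus>\<^bsub>?N\<^esub> b \<in> A. y b) = cls 0" if "finite A" "\<And>b. b \<in> A \<Longrightarrow> y b = cls 0" for A and y :: "('v, 'k) mpol set \<Rightarrow> _"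
    using finsum_stanley_space[OF t Z c that(1), of "\<lambda>_. 0" y] that(2) by simp
  show False
  proof (cases "B = {}")
    \<comment> \<open>An empty basis spans only the zero class, which \<open>nz\<close>
      excludes.\<close>
    case True
    obtain a where a: "P ?m a" using ex1[OF m] by blast
    then have a0: "{b. a b \<noteq> 0} = {}"
      unfolding P_def True by simp
    from a have "?m = (\<Oplus>\<^bsub>?N\<^esub> b \<in> {b. a b \<noteq> 0}. a b \<odot>\<^bsub>M\<^esub> b)"
      unfolding P_def by (elim conjE)
    also have "\<dots> = cls 0"
      unfolding a0 by (rule sum0) simp_all
    finally have "?m = cls 0" .
    then show False using nz by simp
  next
    case False
    then obtain b where b: "b \<in> B" by blast
    \<comment> \<open>By \<open>ann\<close>, the nonzero coefficient \<open>x^s\<close> at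
      \<open>b\<close> represents zero as well, competing with the zero coefficient
      function.\<close>
    let ?a = "\<lambda>x. if x = b then ?s else 0"
    have "P (cls 0) (\<lambda>_. 0)"
      using sum0[of "{}"] by (auto simp: P_def)
    moreover have "P (cls 0) ?a"
      unfolding P_def
    proof (intro conjI)
      have *: "{x. ?a x \<noteq> 0} = {b}"
        by (auto simp flip: keys_eq_empty)
      show "finite {x. ?a x \<noteq> 0}" unfolding * by simp
      show "cls 0 = (\<Oplus>\<^bsub>?N\<^esub> x \<in> {x. ?a x \<noteq> 0}. ?a x \<odot>\<^bsub>M\<^esub> x)"
        unfolding * using ann b B_sub by (intro sum0[symmetric]) auto
    qed (use b s_Z in auto)
    ultimately have "(\<lambda>_. 0) = ?a"
      using ex1[OF z] by blast
    from fun_cong[OF this, of b] have "?s = 0" by simp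
    then show False by (simp flip: keys_eq_empty)
  qed
qed

section \<open>From cone partitions to Stanley decompositions\<close>

lemma internal_direct_sum_cls:
  assumes sub_C: "\<And>i. i < r \<Longrightarrow> C i \<subseteq> TJ - TI"
    and part: "\<And>u. u \<in> TJ - TI \<Longrightarrow> \<exists>!i. i < r \<and> u \<in> C i"
  shows "internal_direct_sum M r (\<lambda>i. cls ` mspan (C i))"
proof -
  have CJ: "mspan (C i) \<subseteq> J" if "i < r" for i
    unfolding J_eq using sub_C[OF that] by (intro mspan_mono) auto
  show ?thesis
    unfolding internal_direct_sum_def
  proof (intro conjI allI impI ballI)
    fix i assume "i < r"
    then show "cls ` mspan (C i) \<subseteq> carrier M"
      using CJ by (auto simp: carrier_M)
  next
    fix x assume "x \<in> carrier M"
    then obtain f where f: "f \<in> J" "x = cls f"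
      by (auto simp: carrier_M)
    \<comment> \<open>The terms of \<open>f\<close> are sorted by the block \<open>C i\<close>
      containing their exponent. Terms with exponent in \<open>TI\<close> are dropped, since they
      vanish in the quotient.\<close>
    define h where "h i = (\<Sum>u\<in>Poly_Mapping.keys f \<inter> C i. Poly_Mapping.single u (Poly_Mapping.lookup f u))" for i
    have h: "h i \<in> mspan (C i)" for i
      unfolding h_def by (intro mspan_sum mspan_single) auto
    have lookup_h: "Poly_Mapping.lookup (h i) u = (if u \<in> C i then Poly_Mapping.lookup f u else 0)" for i u
      by (auto simp: h_def lookup_sum lookup_single when_def in_keys_iff sum.delta sum.delta')
    have "f - (\<Sum>i<r. h i) \<in> I"
      unfolding I_eq mspan_def
    proof (intro CollectI subsetI, rule ccontr)
      fix u assume u: "u \<in> Poly_Mapping.keys (f - sum h {..<r})" "u \<notin> TI"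
      then have nz: "Poly_Mapping.lookup f u \<noteq> (\<Sum>i<r. if u \<in> C i then Poly_Mapping.lookup f u else 0)"
        by (simp add: in_keys_iff lookup_minus lookup_sum lookup_h)
      show False
      proof (cases "u \<in> TJ")
        case True
        with u(2) have "u \<in> TJ - TI" by blast
        from part[OF this] obtain i
          where i: "i < r \<and> u \<in> C i" "\<forall>j. j < r \<and> u \<in> C j \<longrightarrow> j = i"
          by (rule ex1E)
        have C_iff: "u \<in> C j \<longleftrightarrow> j = i" if "j < r" for j
          using i that by blast
        have "(\<Sum>j<r. if u \<in> C j then Poly_Mapping.lookup f u else 0) =
          (\<Sum>j<r. if j = i then Poly_Mapping.lookup f u else 0)"
          by (rule sum.cong) (simp_all add: C_iff)
        with nz i(1) show False by simp
      next
        case False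
        then have "Poly_Mapping.lookup f u = 0"
          using f(1) by (auto simp: J_iff mspan_def in_keys_iff)
        with nz show False by (simp cong: if_cong)
      qed
    qed
    moreover have "(\<Sum>i<r. h i) \<in> J"
      unfolding J_eq by (intro mspan_sum) (use subsetD[OF CJ h] in \<open>simp add: J_iff\<close>)
    ultimately have x: "x = cls (\<Sum>i<r. h i)"
      using f subsetD[OF J_sub] by (simp add: cls_eq_iff)
    show "\<exists>!y. y \<in> (\<Pi>\<^sub>E i \<in> {..<r}. cls ` mspan (C i)) \<and> x = (\<Oplus>\<^bsub>M\<^esub> i \<in> {..<r}. y i)"
    proof (rule ex1I[of _ "restrict (\<lambda>i. cls (h i)) {..<r}"])
      show "restrict (\<lambda>i. cls (h i)) {..<r} \<in> (\<Pi>\<^sub>E i \<in> {..<r}. cls ` mspan (C i)) \<and>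
        x = (\<Oplus>\<^bsub>M\<^esub> i \<in> {..<r}. restrict (\<lambda>i. cls (h i)) {..<r} i)"
      proof
        show "restrict (\<lambda>i. cls (h i)) {..<r} \<in> (\<Pi>\<^sub>E i \<in> {..<r}. cls ` mspan (C i))"
          using h by auto
        show "x = (\<Oplus>\<^bsub>M\<^esub> i \<in> {..<r}. restrict (\<lambda>i. cls (h i)) {..<r} i)"
          unfolding x by (rule finsum_M[symmetric]) (use subsetD[OF CJ h] in simp_all)
      qed
    next
      fix y assume y: "y \<in> (\<Pi>\<^sub>E i \<in> {..<r}. cls ` mspan (C i)) \<and> x = (\<Oplus>\<^bsub>M\<^esub> i \<in> {..<r}. y i)"
      then have "\<forall>i\<in>{..<r}. \<exists>q. q \<in> mspan (C i) \<and> y i = cls q"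
        by (auto dest!: PiE_mem)
      then obtain q where "\<forall>i\<in>{..<r}. q i \<in> mspan (C i) \<and> y i = cls (q i)"
        by (rule bchoice[THEN exE])
      then have q: "\<And>i. i < r \<Longrightarrow> q i \<in> mspan (C i)" "\<And>i. i < r \<Longrightarrow> y i = cls (q i)"
        by simp_all
      have "(\<Oplus>\<^bsub>M\<^esub> i \<in> {..<r}. y i) = cls (\<Sum>i<r. q i)"
        using q subsetD[OF CJ q(1)] by (intro finsum_M) simp_all
      then have eq: "cls (\<Sum>i<r. q i) = cls (\<Sum>i<r. h i)"
        using x y by simp
      \<comment> \<open>Both sums are supported off \<open>TI\<close>, so equality of classes lifts
        to equality of polynomials, and components can then be compared coefficient by
        coefficient.\<close>
      have "(\<Sum>i<r. q i) = (\<Sum>i<r. h i)"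
      proof (rule cls_inj_on[OF _ _ _ _ eq, where C = "TJ - TI"])
        have C: "p \<in> mspan (TJ - TI)" if "i < r" "p \<in> mspan (C i)" for i and p :: "('v, 'k) mpol"
          using subsetD[OF mspan_mono[OF sub_C[OF that(1)]] that(2)] .
        show "(\<Sum>i<r. q i) \<in> mspan (TJ - TI)"
          by (rule mspan_sum) (use C q(1) in simp)
        show "(\<Sum>i<r. h i) \<in> mspan (TJ - TI)"
          by (rule mspan_sum) (use C h in simp)
      qed (use TJ_sub in auto)
      then have sums: "(\<Sum>i<r. Poly_Mapping.lookup (q i) u) = (\<Sum>i<r. Poly_Mapping.lookup (h i) u)" for u
        by (simp flip: lookup_sum)
      \<comment> \<open>Blocks are disjoint, so at an exponent of \<open>C i\<close> only the
        component with index \<open>i\<close> contributes.\<close>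
      have single: "(\<Sum>j<r. Poly_Mapping.lookup (k j) u) = Poly_Mapping.lookup (k i) u"
        if "i < r" "u \<in> C i" "\<And>j. j < r \<Longrightarrow> k j \<in> mspan (C j)" for i u and k :: "nat \<Rightarrow> ('v, 'k) mpol"
      proof -
        have "Poly_Mapping.lookup (k j) u = 0" if "j < r" "j \<noteq> i" for j
        proof -
          have "u \<in> TJ - TI" using sub_C[OF \<open>i < r\<close>] \<open>u \<in> C i\<close> by blast
          from part[OF this] have "u \<notin> C j"
          proof (rule ex1E)
            fix l assume "\<forall>k. k < r \<and> u \<in> C k \<longrightarrow> k = l"
            then show ?thesis using \<open>u \<in> C i\<close> \<open>i < r\<close> that by blast
          qed
          then show ?thesis
            using lookup_mspan[OF \<open>\<And>j. j < r \<Longrightarrow> k j \<in> mspan (C j)\<close>[OF \<open>j < r\<close>]] by simp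
        qed
        then have "(\<Sum>j<r. Poly_Mapping.lookup (k j) u) = (\<Sum>j<r. if j = i then Poly_Mapping.lookup (k i) u else 0)"
          by (intro sum.cong) auto
        then show ?thesis using \<open>i < r\<close> by simp
      qed
      have "q i = h i" if "i < r" for i
      proof (rule poly_mapping_eqI)
        fix u show "Poly_Mapping.lookup (q i) u = Poly_Mapping.lookup (h i) u"
        proof (cases "u \<in> C i")
          case True
          then show ?thesis
            using single[OF that True, of q] single[OF that True, of h] q(1) h sums[of u] by simp
        next
          case False
          then show ?thesis
            using lookup_mspan[OF q(1)[OF that]] lookup_mspan[OF h[of i]] by simp
        qed
      qed
      then have "y i = cls (h i)" if "i < r" for i
        using q(2) that by simp
      moreover have "y \<in> extensional {..<r}"
        using y by (simp add: PiE_def)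
      ultimately show "y = restrict (\<lambda>i. cls (h i)) {..<r}"
        by (intro extensionalityI[of _ "{..<r}"]) simp_all
    qed
  qed
qed

text \<open>Each cone \<open>(t, Z)\<close> contributes the summand generated by the class of
  \<open>x^t\<close>. Enumerating \<open>E\<close> without repetition turns the unique cone through
  an exponent into a unique index.\<close>

lemma stanley_decomposition_of_cone_partition:
  assumes E: "cone_partition V (TJ - TI) E"
  shows "\<exists>D. stanley_decomposition V M D \<and> length D = card E"
proof -
  obtain L where L: "set L = E" "distinct L"
    using E finite_distinct_list[of E] by (auto simp: cone_partition_def)
  have L_i: "snd (L ! i) \<subseteq> V \<and> cone (fst (L ! i)) (snd (L ! i)) \<subseteq> TJ - TI \<and> fst (L ! i) \<in> TJ" if "i < length L" for i
  proof -
    have "L ! i \<in> E" using L that by auto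
    then have "snd (L ! i) \<subseteq> V" "cone (fst (L ! i)) (snd (L ! i)) \<subseteq> TJ - TI"
      using E by (auto simp: cone_partition_def split_beta)
    then show ?thesis using cone_self by blast
  qed
  define D where "D = map (\<lambda>e. (cls (Poly_Mapping.single (fst e) 1), snd e)) L"
  let ?W = "\<lambda>i. stanley_space M (fst (D ! i)) (snd (D ! i))"
  have W: "?W i = cls ` mspan (cone (fst (L ! i)) (snd (L ! i)))" if "i < length L" for i
    using L_i[OF that] that by (simp add: D_def stanley_space_cone)
  have "internal_direct_sum M (length L) (\<lambda>i. cls ` mspan (cone (fst (L ! i)) (snd (L ! i))))"
  proof (rule internal_direct_sum_cls)
    fix u assume "u \<in> TJ - TI"
    with E have "\<exists>!e. e \<in> E \<and> u \<in> cone (fst e) (snd e)"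
      by (simp add: cone_partition_def)
    then obtain e where e: "e \<in> E \<and> u \<in> cone (fst e) (snd e)"
      and uniq: "\<forall>e'. e' \<in> E \<and> u \<in> cone (fst e') (snd e') \<longrightarrow> e' = e"
      by (rule ex1E)
    from e L(1) obtain i where i: "i < length L" "L ! i = e"
      by (auto simp: in_set_conv_nth)
    show "\<exists>!i. i < length L \<and> u \<in> cone (fst (L ! i)) (snd (L ! i))"
    proof (rule ex1I[of _ i])
      fix j assume j: "j < length L \<and> u \<in> cone (fst (L ! j)) (snd (L ! j))"
      then have "L ! j \<in> E" using L(1) by auto
      with j uniq have "L ! j = e" by blast
      then show "j = i"
        using i j L(2) nth_eq_iff_index_eq by blast
    qed (use i e in simp)
  qed (use L_i in simp)
  moreover have "internal_direct_sum M (length L) ?W \<longleftrightarrow>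
      internal_direct_sum M (length L) (\<lambda>i. cls ` mspan (cone (fst (L ! i)) (snd (L ! i))))"
    by (rule internal_direct_sum_cong) (rule W)
  ultimately have "internal_direct_sum M (length L) ?W"
    by blast
  then have "internal_direct_sum M (length D) ?W"
    by (simp only: D_def length_map)
  moreover have "m \<in> carrier M \<and> homogeneous M m \<and> Z \<subseteq> V \<and>
        free_module (poly_ring Z :: ('v, 'k) mpol ring) (M\<lparr>carrier := stanley_space M m Z\<rparr>)" if mZ: "(m, Z) \<in> set D" for m Z
  proof -
    obtain i where i: "i < length L" "m = cls (Poly_Mapping.single (fst (L ! i)) 1)" "Z = snd (L ! i)"
      using mZ by (auto simp: D_def in_set_conv_nth)
    let ?t = "fst (L ! i)"
    have t: "?t \<in> TJ" "Z \<subseteq> V" "cone ?t Z \<inter> TI = {}"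
      using L_i[OF i(1)] i(3) by auto
    have "(Poly_Mapping.single ?t 1 :: ('v, 'k) mpol) \<in> J"
      using t by (simp add: J_iff mspan_single)
    then have "m \<in> carrier M" "m \<in> component M (\<lambda>v. int (Poly_Mapping.lookup ?t v))"
      using i(2) by (auto simp: carrier_M component_M)
    then show ?thesis
      using free_stanley_space[OF t] t i(2) by (auto simp: homogeneous_def)
  qed
  ultimately have "stanley_decomposition V M D"
    by (auto simp: stanley_decomposition_def)
  then show ?thesis
    using L by (auto simp: D_def distinct_card)
qed

section \<open>From Stanley decompositions to cone partitions\<close>

lemma homogeneousE:
  assumes "homogeneous M m" "m \<noteq> cls 0"
  obtains t c where "t \<in> TJ" "c \<noteq> 0" "m = cls (Poly_Mapping.single t c)"
proof -
  obtain d f where f: "f \<in> J" "m = cls f"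
    "\<And>t v. t \<in> Poly_Mapping.keys f \<Longrightarrow> int (Poly_Mapping.lookup t v) = d v"
    using assms(1) by (auto simp: homogeneous_def component_M)
  have "f \<noteq> 0" using f(2) assms(2) by auto
  then have "Poly_Mapping.keys f \<noteq> {}" by simp
  then obtain t where t: "t \<in> Poly_Mapping.keys f" by blast
  \<comment> \<open>The degree records every entry of an exponent, so a homogeneous representative
    has a single term.\<close>
  have "s = t" if "s \<in> Poly_Mapping.keys f" for s
  proof (rule poly_mapping_eqI)
    fix v
    have "int (Poly_Mapping.lookup s v) = int (Poly_Mapping.lookup t v)"
      by (simp only: f(3)[OF that] f(3)[OF t])
    then show "Poly_Mapping.lookup s v = Poly_Mapping.lookup t v"
      by (simp only: of_nat_eq_iff)
  qed
  then have "Poly_Mapping.keys f = {t}" using t by blast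
  then have f_eq: "f = Poly_Mapping.single t (Poly_Mapping.lookup f t)"
    using poly_mapping_sum_singles[of f] by simp
  show thesis
  proof (rule that)
    show "t \<in> TJ" using f(1) t by (auto simp: J_iff mspan_def)
    show "Poly_Mapping.lookup f t \<noteq> 0" using t by (simp add: in_keys_iff)
    show "m = cls (Poly_Mapping.single t (Poly_Mapping.lookup f t))"
      using f(2) f_eq by simp
  qed
qed

text \<open>Testing the direct sum on the class of a single monomial \<open>x^u\<close> recovers the
  partition: existence of a representation shows that the cones cover, and its uniqueness shows that
  they are disjoint.\<close>

lemma cone_partition_of_stanley_decomposition:
  assumes D: "stanley_decomposition V M D"
  shows "\<exists>E. cone_partition V (TJ - TI) E \<and> card E \<le> length D"
proof -
  let ?r = "length D"
  let ?m = "\<lambda>i. fst (D ! i)" and ?Z = "\<lambda>i. snd (D ! i)"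
  let ?W = "\<lambda>i. stanley_space M (?m i) (?Z i)"
  have D_i: "?m i \<in> carrier M \<and> homogeneous M (?m i) \<and> ?Z i \<subseteq> V \<and>
      free_module (poly_ring (?Z i) :: ('v, 'k) mpol ring) (M\<lparr>carrier := ?W i\<rparr>)" if "i < ?r" for i
    using D nth_mem[OF that] unfolding stanley_decomposition_def by (auto simp: split_beta)
  have "internal_direct_sum M ?r ?W"
    using D by (simp add: stanley_decomposition_def)
  then have ex1_sum: "\<exists>!y. y \<in> (\<Pi>\<^sub>E i \<in> {..<?r}. ?W i) \<and> x = (\<Oplus>\<^bsub>M\<^esub> i \<in> {..<?r}. y i)"
    if "x \<in> carrier M" for x
    using that by (simp add: internal_direct_sum_def)
  \<comment> \<open>Zero generators are allowed, since the zero module is free on the empty basis.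
    They carry no cone and are discarded, which is why only \<open>card E \<le> length D\<close> is
    claimed.\<close>
  define N where "N = {i. i < ?r \<and> ?m i \<noteq> cls 0}"
  have "\<exists>t c. t \<in> TJ \<and> c \<noteq> 0 \<and> ?m i = cls (Poly_Mapping.single t c)" if "i \<in> N" for i
  proof -
    have "homogeneous M (?m i)" "?m i \<noteq> cls 0" using D_i that by (simp_all add: N_def)
    then show ?thesis by (rule homogeneousE) blast
  qed
  then obtain t c where tc: "\<And>i. i \<in> N \<Longrightarrow> t i \<in> TJ" "\<And>i. i \<in> N \<Longrightarrow> c i \<noteq> 0"
      "\<And>i. i \<in> N \<Longrightarrow> ?m i = cls (Poly_Mapping.single (t i) (c i))"
    by metis
  have N_r: "i < ?r" if "i \<in> N" for i using that by (simp add: N_def)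
  have Z_V: "?Z i \<subseteq> V" if "i \<in> N" for i using D_i[OF N_r[OF that]] by simp
  have W: "?W i = cls ` mspan (cone (t i) (?Z i))" if "i \<in> N" for i
    using tc[OF that] Z_V[OF that] by (simp add: stanley_space_cone)
  have W0: "?W i = {cls 0}" if "i < ?r" "i \<notin> N" for i
  proof -
    have "?m i = cls 0" using that by (simp add: N_def)
    moreover have "p \<odot>\<^bsub>M\<^esub> cls 0 = cls 0" if "p \<in> mspan (expos (?Z i))" for p
      using smult_M[of p 0] that mspan_mono[OF expos_mono[of "?Z i" V]] D_i[OF \<open>i < ?r\<close>] by auto
    ultimately show ?thesis
      by (auto simp: stanley_space_def intro: exI[of _ 0])
  qed
  have dis: "cone (t i) (?Z i) \<inter> TI = {}" if "i \<in> N" for i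
    using that D_i[OF N_r[OF that]] tc[OF that]
    by (intro free_stanley_space_disjoint[where c = "c i"]) (auto simp: N_def)
  have C_sub: "cone (t i) (?Z i) \<subseteq> TJ - TI" if "i \<in> N" for i
    using dis[OF that] cone_sub_TJ[OF tc(1)[OF that] Z_V[OF that]] by blast
  have cover: "\<exists>i\<in>N. u \<in> cone (t i) (?Z i)" if u: "u \<in> TJ - TI" for u
  proof (rule ccontr)
    assume neg: "\<not> (\<exists>i\<in>N. u \<in> cone (t i) (?Z i))"
    let ?u = "Poly_Mapping.single u 1 :: ('v, 'k) mpol"
    have uJ: "?u \<in> J" using u by (simp add: J_iff mspan_single)
    then have "cls ?u \<in> carrier M" by (simp add: carrier_M)
    from ex1_sum[OF this] obtain y
      where y: "y \<in> (\<Pi>\<^sub>E i \<in> {..<?r}. ?W i) \<and> cls ?u = (\<Oplus>\<^bsub>M\<^esub> i \<in> {..<?r}. y i)"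
      by (rule ex1E)
    have y_W: "y i \<in> ?W i" if "i < ?r" for i
      using PiE_mem[OF conjunct1[OF y], of i] that by simp
    \<comment> \<open>If no cone contains \<open>u\<close>, every component has a representative
      without \<open>x^u\<close>. Then \<open>x^u\<close> minus their sum lies in \<open>I\<close>
      and has coefficient 1 at \<open>u\<close>, contradicting that \<open>u\<close> is outside
      \<open>TI\<close>.\<close>
    have "\<exists>q. q \<in> J \<and> y i = cls q \<and> Poly_Mapping.lookup q u = 0" if "i < ?r" for i
    proof (cases "i \<in> N")
      case True
      then obtain q where q: "q \<in> mspan (cone (t i) (?Z i))" "y i = cls q"
        using y_W[OF \<open>i < ?r\<close>] W by blast
      moreover have "q \<in> J"
        using q(1) C_sub[OF True] by (auto simp: J_iff mspan_def)
      moreover have "Poly_Mapping.lookup q u = 0"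
        using q(1) neg True by (auto simp: mspan_def in_keys_iff)
      ultimately show ?thesis by blast
    next
      case False
      then have "y i = cls 0" using y_W[OF that] W0[OF that] by blast
      then show ?thesis by (auto simp: J_iff intro: exI[of _ 0])
    qed
    then obtain q where q: "\<And>i. i < ?r \<Longrightarrow> q i \<in> J" "\<And>i. i < ?r \<Longrightarrow> y i = cls (q i)"
      "\<And>i. i < ?r \<Longrightarrow> Poly_Mapping.lookup (q i) u = 0"
      by metis
    have "(\<Oplus>\<^bsub>M\<^esub> i \<in> {..<?r}. y i) = cls (\<Sum>i<?r. q i)"
      using q by (intro finsum_M) auto
    moreover have "(\<Sum>i<?r. q i) \<in> J"
      using q(1) unfolding J_eq by (intro mspan_sum) auto
    ultimately have "?u - (\<Sum>i<?r. q i) \<in> I"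
      using y uJ J_sub by (subst cls_eq_iff[symmetric]) auto
    moreover have "u \<in> Poly_Mapping.keys (?u - (\<Sum>i<?r. q i))"
      using q(3) by (simp add: in_keys_iff lookup_minus lookup_sum)
    ultimately show False using u by (auto simp: I_iff mspan_def)
  qed
  have unique: "i = j" if ij: "i \<in> N" "j \<in> N" "u \<in> cone (t i) (?Z i)" "u \<in> cone (t j) (?Z j)" for i j u
  proof (rule ccontr)
    assume "i \<noteq> j"
    let ?u = "Poly_Mapping.single u 1 :: ('v, 'k) mpol"
    have u: "u \<in> TJ - TI" using C_sub ij by blast
    then have uJ: "?u \<in> J" by (simp add: J_iff mspan_single)
    have inW: "cls 0 \<in> ?W k" if "k < ?r" for k
      using W[of k] W0[of k] that by (cases "k \<in> N") auto
    \<comment> \<open>If \<open>u\<close> lies in two cones, the class of \<open>x^u\<close> can be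
      placed entirely in slot \<open>i\<close> or entirely in slot \<open>j\<close>. Uniqueness
      identifies the two families, and comparing them at slot \<open>i\<close> makes the class
      zero.\<close>
    have *: "restrict (\<lambda>k. if k = l then cls ?u else cls 0) {..<?r} \<in> (\<Pi>\<^sub>E i \<in> {..<?r}. ?W i) \<and>
      cls ?u = (\<Oplus>\<^bsub>M\<^esub> k \<in> {..<?r}. restrict (\<lambda>k. if k = l then cls ?u else cls 0) {..<?r} k)"
      if l: "l \<in> N" "u \<in> cone (t l) (?Z l)" for l
    proof
      have "cls ?u \<in> ?W l"
        using l W by (auto intro!: imageI mspan_single)
      then show "restrict (\<lambda>k. if k = l then cls ?u else cls 0) {..<?r} \<in> (\<Pi>\<^sub>E i \<in> {..<?r}. ?W i)"
        using inW by auto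
      have "(\<Oplus>\<^bsub>M\<^esub> k \<in> {..<?r}. restrict (\<lambda>k. if k = l then cls ?u else cls 0) {..<?r} k)
        = cls (\<Sum>k<?r. if k = l then ?u else 0)"
        using uJ by (intro finsum_M) (auto simp: J_iff)
      then show "cls ?u = (\<Oplus>\<^bsub>M\<^esub> k \<in> {..<?r}. restrict (\<lambda>k. if k = l then cls ?u else cls 0) {..<?r} k)"
        using N_r[OF l(1)] by simp
    qed
    have "cls ?u \<in> carrier M" using uJ by (simp add: carrier_M)
    from ex1_sum[OF this] obtain y where
      uniq: "\<forall>y'. y' \<in> (\<Pi>\<^sub>E i \<in> {..<?r}. ?W i) \<and> cls ?u = (\<Oplus>\<^bsub>M\<^esub> i \<in> {..<?r}. y' i) \<longrightarrow> y' = y"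
      by (rule ex1E)
    have "restrict (\<lambda>k. if k = i then cls ?u else cls 0) {..<?r} = restrict (\<lambda>k. if k = j then cls ?u else cls 0) {..<?r}"
      by (rule trans[OF uniq[rule_format, OF *[OF ij(1,3)]] uniq[rule_format, OF *[OF ij(2,4)], symmetric]])
    from fun_cong[OF this, of i] have "cls ?u = cls 0"
      using N_r[OF ij(1)] \<open>i \<noteq> j\<close> by simp
    then have "?u \<in> I"
      using cls_eq_iff[of ?u 0] uJ J_sub by auto
    then show False using u by (simp add: I_iff mspan_def)
  qed
  define E where "E = (\<lambda>i. (t i, ?Z i)) ` N"
  have "finite N" "N \<subseteq> {..<?r}" by (auto simp: N_def)
  have "card E \<le> card N"
    unfolding E_def by (rule card_image_le) fact
  also have "\<dots> \<le> ?r"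
    using card_mono[OF _ \<open>N \<subseteq> {..<?r}\<close>] by simp
  finally have "card E \<le> ?r" .
  moreover have "cone_partition V (TJ - TI) E"
    unfolding cone_partition_def
  proof (intro conjI ballI)
    fix u assume "u \<in> TJ - TI"
    then obtain i where i: "i \<in> N" "u \<in> cone (t i) (?Z i)" using cover by blast
    then show "\<exists>!e. e \<in> E \<and> u \<in> cone (fst e) (snd e)"
      by (intro ex1I[of _ "(t i, ?Z i)"]) (auto simp: E_def dest: unique)
  qed (use \<open>finite N\<close> Z_V C_sub in \<open>auto simp: E_def\<close>)
  ultimately show ?thesis by blast
qed

end

section \<open>Polarization\<close>

lemma closed_expos_le:
  assumes "closed_expos V T" "t \<in> T" "u \<in> expos V"
    "\<And>v. Poly_Mapping.lookup t v \<le> Poly_Mapping.lookup u v"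
  shows "u \<in> T"
proof -
  have "u - t \<in> expos V"
    using assms(3) by (simp add: expos_iff lookup_minus)
  then have "t + (u - t) \<in> T"
    using assms(1,2) by (simp add: closed_expos_def)
  then show ?thesis
    by (simp only: add_diff_expo[OF assms(4)])
qed

text \<open>Among the divisors of \<open>x^u\<close> lying in \<open>I\<close>, one of least total
  degree is a minimal generator: a proper divisor of it in \<open>I\<close> would have smaller
  degree.\<close>

lemma ex_min_gens_le:
  assumes "monom_of u \<in> I"
  shows "\<exists>t\<in>min_gens I. \<forall>v. Poly_Mapping.lookup t v \<le> Poly_Mapping.lookup u v"
proof -
  let ?P = "\<lambda>s. monom_of s \<in> I \<and> (\<forall>v. Poly_Mapping.lookup s v \<le> Poly_Mapping.lookup u v)"
  \<comment> \<open>Summing over the support of \<open>u\<close> gives the full degree, because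
    divisors of \<open>x^u\<close> involve no further variables.\<close>
  let ?f = "\<lambda>s. \<Sum>v\<in>Poly_Mapping.keys u. Poly_Mapping.lookup s v"
  have "?P u" using assms by simp
  from ex_has_least_nat[of ?P, OF this, of ?f]
  obtain t where t: "?P t" and least: "\<And>s. ?P s \<Longrightarrow> ?f t \<le> ?f s"
    by blast
  have "s = t" if s: "monom_of s \<in> I" "\<forall>v. Poly_Mapping.lookup s v \<le> Poly_Mapping.lookup t v" for s
  proof (rule poly_mapping_eqI)
    fix v
    have "?P s" using t s le_trans by blast
    then have "?f t \<le> ?f s" by (rule least)
    show "Poly_Mapping.lookup s v = Poly_Mapping.lookup t v"
    proof (cases "v \<in> Poly_Mapping.keys u")
      case True
      show ?thesis
      proof (rule ccontr)
        assume "Poly_Mapping.lookup s v \<noteq> Poly_Mapping.lookup t v"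
        then have "Poly_Mapping.lookup s v < Poly_Mapping.lookup t v"
          using s(2) by (simp add: le_neq_implies_less)
        then have "?f s < ?f t"
          using s(2) True by (intro sum_strict_mono_ex1) auto
        with \<open>?f t \<le> ?f s\<close> show False by simp
      qed
    next
      case False
      then have "Poly_Mapping.lookup u v = 0" by (simp add: in_keys_iff)
      then show ?thesis using t s by (metis le_zero_eq)
    qed
  qed
  then have "t \<in> min_gens I" using t by (simp add: min_gens_def)
  then show ?thesis using t by blast
qed

lemma monomial_idealE:
  assumes "monomial_ideal V I"
  obtains T where "closed_expos V T" "I = mspan T"
proof -
  obtain A where "A \<subseteq> expos V" "I = Idl\<^bsub>poly_ring V\<^esub> (monom_of ` A)"
    using assms by (auto simp: monomial_ideal_def)
  then show thesis
    using that[OF closed_expos_up[of A V]] by (simp add: Idl_monoms)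
qed

lemma min_gens_mspan: "min_gens (mspan T :: ('v, 'k::field) mpol set) \<subseteq> T"
  by (auto simp: min_gens_def monom_of_mspan)

section \<open>Existence of a finite cone partition\<close>

definition cap :: "('v \<Rightarrow> nat) \<Rightarrow> 'v expo \<Rightarrow> 'v expo" where
  "cap g u = Abs_poly_mapping (\<lambda>j. min (Poly_Mapping.lookup u j) (g j))"

lemma lookup_cap [simp]: "Poly_Mapping.lookup (cap g u) j = min (Poly_Mapping.lookup u j) (g j)"
proof -
  have "{j. min (Poly_Mapping.lookup u j) (g j) \<noteq> 0} \<subseteq> Poly_Mapping.keys u"
    by (auto simp: in_keys_iff)
  then show ?thesis
    unfolding cap_def by (subst lookup_Abs_poly_mapping) (auto dest: finite_subset)
qed

lemma finite_bounded_expos: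
  fixes V :: "'v set"
  assumes "finite V"
  shows "finite {s \<in> expos V. \<forall>j\<in>V. Poly_Mapping.lookup s j \<le> g j}"
proof (rule finite_imageD)
  let ?r = "\<lambda>s :: 'v expo. restrict (Poly_Mapping.lookup s) V"
  show "inj_on ?r {s \<in> expos V. \<forall>j\<in>V. Poly_Mapping.lookup s j \<le> g j}"
  proof (rule inj_onI, rule poly_mapping_eqI)
    fix s s' v assume s: "s \<in> {s \<in> expos V. \<forall>j\<in>V. Poly_Mapping.lookup s j \<le> g j}"
      "s' \<in> {s \<in> expos V. \<forall>j\<in>V. Poly_Mapping.lookup s j \<le> g j}" and eq: "?r s = ?r s'"
    show "Poly_Mapping.lookup s v = Poly_Mapping.lookup s' v"
      using fun_cong[OF eq, of v] s by (cases "v \<in> V") (auto simp: expos_iff)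
  qed
  have "?r ` {s \<in> expos V. \<forall>j\<in>V. Poly_Mapping.lookup s j \<le> g j} \<subseteq> (\<Pi>\<^sub>E j\<in>V. {..g j})"
    by auto
  then show "finite (?r ` {s \<in> expos V. \<forall>j\<in>V. Poly_Mapping.lookup s j \<le> g j})"
    by (rule finite_subset) (use assms in \<open>simp add: finite_PiE\<close>)
qed

text \<open>Identifies the fibres of \<open>cap g\<close>: where \<open>s\<close> lies below the
  bound, the entry of \<open>u\<close> is determined; where \<open>s\<close> has reached it, any
  larger entry is capped to the same value.\<close>

lemma mem_cone_cap_iff:
  assumes s: "s \<in> expos V" "\<And>j. j \<in> V \<Longrightarrow> Poly_Mapping.lookup s j \<le> g j" and u: "u \<in> expos V"
  shows "u \<in> cone s {j\<in>V. Poly_Mapping.lookup s j = g j} \<longleftrightarrow> cap g u = s"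
proof
  assume "u \<in> cone s {j\<in>V. Poly_Mapping.lookup s j = g j}"
  then have c: "Poly_Mapping.lookup s j \<le> Poly_Mapping.lookup u j"
    "j \<notin> V \<or> Poly_Mapping.lookup s j \<noteq> g j \<Longrightarrow> Poly_Mapping.lookup u j = Poly_Mapping.lookup s j" for j
    by (auto simp: cone_def)
  show "cap g u = s"
  proof (rule poly_mapping_eqI)
    fix j
    show "Poly_Mapping.lookup (cap g u) j = Poly_Mapping.lookup s j"
    proof (cases "j \<in> V")
      case True
      then show ?thesis using c[of j] s(2)[of j] by (cases "Poly_Mapping.lookup s j = g j") auto
    next
      case False
      then show ?thesis using s(1) u by (simp add: expos_iff)
    qed
  qed
next
  assume "cap g u = s"
  then have eq: "Poly_Mapping.lookup s j = min (Poly_Mapping.lookup u j) (g j)" for j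
    by (metis lookup_cap)
  show "u \<in> cone s {j\<in>V. Poly_Mapping.lookup s j = g j}"
    using u by (auto simp: cone_def eq min_def expos_iff)
qed

text \<open>
  A decomposition has to exist at all, since \<^const>\<open>slength\<close> is an unspecified number otherwise.
  If membership in \<open>A\<close> depends only on \<open>min u g\<close>, then the fibres of \<open>u \<mapsto> min u g\<close> are cones.
\<close>

lemma ex_cone_partition:
  assumes V: "finite V" and A: "A \<subseteq> expos V" and cap_A: "\<And>u. u \<in> expos V \<Longrightarrow> cap g u \<in> A \<longleftrightarrow> u \<in> A"
  shows "\<exists>E. cone_partition V A E"
proof -
  let ?Z = "\<lambda>s. {j\<in>V. Poly_Mapping.lookup s j = g j}"
  \<comment> \<open>The values of \<open>cap g\<close> on \<open>A\<close>, finitely many, index the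
    fibres.\<close>
  let ?S = "{s \<in> A. \<forall>j\<in>V. Poly_Mapping.lookup s j \<le> g j}"
  have S: "s \<in> expos V" "\<And>j. j \<in> V \<Longrightarrow> Poly_Mapping.lookup s j \<le> g j" if "s \<in> ?S" for s
    using that A by auto
  have "finite ?S"
    by (rule finite_subset[OF _ finite_bounded_expos[OF V, of g]]) (use A in auto)
  have "cone_partition V A ((\<lambda>s. (s, ?Z s)) ` ?S)"
    unfolding cone_partition_def
  proof (intro conjI ballI)
    show "finite ((\<lambda>s. (s, ?Z s)) ` ?S)" using \<open>finite ?S\<close> by simp
  next
    fix e assume "e \<in> (\<lambda>s. (s, ?Z s)) ` ?S"
    then obtain s where s: "s \<in> ?S" "e = (s, ?Z s)" by blast
    have "u \<in> A" if u: "u \<in> cone s (?Z s)" for u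
    proof -
      have "u \<in> expos V"
        using subsetD[OF cone_subset_expos[OF S(1)[OF s(1)], of "?Z s"] u] by simp
      then show ?thesis
        using mem_cone_cap_iff[OF S[OF s(1)], of u] cap_A[of u] u s(1) by auto
    qed
    then show "case e of (t, Z) \<Rightarrow> Z \<subseteq> V \<and> cone t Z \<subseteq> A"
      using s(2) by auto
  next
    fix u assume u: "u \<in> A"
    then have uV: "u \<in> expos V" using A by blast
    have cu: "cap g u \<in> ?S" using cap_A[OF uV] u by simp
    show "\<exists>!e. e \<in> (\<lambda>s. (s, ?Z s)) ` ?S \<and> u \<in> cone (fst e) (snd e)"
    proof (rule ex1I[of _ "(cap g u, ?Z (cap g u))"])
      show "(cap g u, ?Z (cap g u)) \<in> (\<lambda>s. (s, ?Z s)) ` ?S \<and>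
        u \<in> cone (fst (cap g u, ?Z (cap g u))) (snd (cap g u, ?Z (cap g u)))"
        using imageI[OF cu, of "\<lambda>s. (s, ?Z s)"] mem_cone_cap_iff[OF S[OF cu] uV] by (simp only: fst_conv snd_conv simp_thms)
    next
      fix e assume e: "e \<in> (\<lambda>s. (s, ?Z s)) ` ?S \<and> u \<in> cone (fst e) (snd e)"
      then obtain s where s: "s \<in> ?S" "e = (s, ?Z s)" by blast
      then have "cap g u = s"
        using mem_cone_cap_iff[OF S[OF s(1)] uV] e by simp
      then show "e = (cap g u, ?Z (cap g u))" using s(2) by blast
    qed
  qed
  then show ?thesis by blast
qed

text \<open>Minimal generators have exponents bounded by \<open>g\<close>, so whether one of them
  divides \<open>x^u\<close> is unaffected by capping.\<close>

lemma cap_mem_iff: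
  assumes T: "closed_expos {1..n} T" and bound: "pol_bound n g (mspan T :: (nat, 'k::field) mpol set)"
    and u: "u \<in> expos {1..n}"
  shows "cap g u \<in> T \<longleftrightarrow> u \<in> T"
proof
  assume "cap g u \<in> T"
  then show "u \<in> T" by (rule closed_expos_le[OF T _ u]) simp
next
  assume "u \<in> T"
  then have "monom_of u \<in> (mspan T :: (nat, 'k) mpol set)" by (simp add: monom_of_mspan)
  then obtain t where t: "t \<in> min_gens (mspan T :: (nat, 'k) mpol set)"
      "\<And>v. Poly_Mapping.lookup t v \<le> Poly_Mapping.lookup u v"
    using ex_min_gens_le by blast
  have tT: "t \<in> T" using t(1) min_gens_mspan by blast
  show "cap g u \<in> T"
  proof (rule closed_expos_le[OF T tT])
    show "cap g u \<in> expos {1..n}" using u by (simp add: expos_iff)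
    fix v
    have "Poly_Mapping.lookup t v \<le> g v"
    proof (cases "v \<in> {1..n}")
      case True
      then show ?thesis using bound t(1) by (simp add: pol_bound_def)
    next
      case False
      then show ?thesis using u t(2)[of v] by (simp add: expos_iff)
    qed
    then show "Poly_Mapping.lookup t v \<le> Poly_Mapping.lookup (cap g u) v"
      using t(2) by simp
  qed
qed

section \<open>Polarized exponents and initial runs\<close>

definition pol_expo :: "nat \<Rightarrow> nat expo \<Rightarrow> (nat \<times> nat) expo" where
  "pol_expo n t = (\<Sum>j = 1..n. \<Sum>k = 1..Poly_Mapping.lookup t j. Poly_Mapping.single (j, k) 1)"

lemma lookup_pol_expo:
  "Poly_Mapping.lookup (pol_expo n t) (j, k) =
    (if j \<in> {1..n} \<and> k \<in> {1..Poly_Mapping.lookup t j} then 1 else 0)"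
proof -
  have "Poly_Mapping.lookup (pol_expo n t) (j, k) =
    (\<Sum>i = 1..n. if i = j then (\<Sum>l = 1..Poly_Mapping.lookup t i. if l = k then 1 else 0) else 0)"
    unfolding pol_expo_def lookup_sum by (intro sum.cong) (auto simp: lookup_single when_def)
  then show ?thesis by (simp add: sum.delta)
qed

lemma monom_of_add: "monom_of (s + t) = (monom_of s * monom_of t :: ('v, 'k::field) mpol)"
  by (simp add: monom_of_def mult_single)

lemma monom_of_sum: "monom_of (sum f A) = (\<Prod>i\<in>A. monom_of (f i) :: ('v, 'k::field) mpol)"
  by (induction A rule: infinite_finite_induct) (simp_all add: monom_of_add, simp_all add: monom_of_def)

lemma pol_mono_eq: "pol_mono n t = monom_of (pol_expo n t)"
  by (simp add: pol_mono_def pol_expo_def monom_of_sum indet_def)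

text \<open>Second indices start at 1, so the run has length \<open>k\<close> when
  \<open>(j, Suc k)\<close> is the first position with entry zero.\<close>

definition depol :: "(nat \<times> nat) expo \<Rightarrow> nat expo" where
  "depol u = Abs_poly_mapping (\<lambda>j. LEAST k. Poly_Mapping.lookup u (j, Suc k) = 0)"

text \<open>A positive run at \<open>j\<close> needs a nonzero entry at \<open>(j, 1)\<close>, so
  only finitely many runs are positive and \<open>Abs_poly_mapping\<close> is applied to a function
  of finite support.\<close>

lemma lookup_depol: "Poly_Mapping.lookup (depol u) j = (LEAST k. Poly_Mapping.lookup u (j, Suc k) = 0)"
proof -
  have "j \<in> fst ` Poly_Mapping.keys u" if "(LEAST k. Poly_Mapping.lookup u (j, Suc k) = 0) \<noteq> 0" for j
  proof -
    have "Poly_Mapping.lookup u (j, Suc 0) \<noteq> 0"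
      using that by (rule contrapos_nn) (rule Least_eq_0)
    then show ?thesis
      by (intro image_eqI[of _ _ "(j, Suc 0)"]) (simp_all add: in_keys_iff)
  qed
  then have "{j. (LEAST k. Poly_Mapping.lookup u (j, Suc k) = 0) \<noteq> 0} \<subseteq> fst ` Poly_Mapping.keys u"
    by (intro subsetI) (simp only: mem_Collect_eq)
  then have "finite {j. (LEAST k. Poly_Mapping.lookup u (j, Suc k) = 0) \<noteq> 0}"
    by (rule finite_subset) simp
  then show ?thesis
    unfolding depol_def by (simp only: lookup_Abs_poly_mapping)
qed

text \<open>The working description of \<open>depol\<close>. Finite support of \<open>u\<close>
  guarantees a zero entry in each row, so the least one is attained.\<close>

lemma le_depol_iff:
  "a \<le> Poly_Mapping.lookup (depol u) j \<longleftrightarrow> (\<forall>k\<in>{1..a}. Poly_Mapping.lookup u (j, k) \<noteq> 0)"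
proof -
  let ?P = "\<lambda>k. Poly_Mapping.lookup u (j, Suc k) = 0"
  have "\<exists>k. ?P k"
  proof (rule ccontr)
    assume "\<not> (\<exists>k. ?P k)"
    then have "range (\<lambda>k. (j, Suc k)) \<subseteq> Poly_Mapping.keys u"
      by (auto simp: in_keys_iff)
    then have "finite (range (\<lambda>k. (j, Suc k)))"
      using finite_subset finite_keys by blast
    moreover have "inj (\<lambda>k. (j, Suc k))" by (simp add: inj_def)
    ultimately show False
      using finite_imageD infinite_UNIV_nat by blast
  qed
  then have "?P (Least ?P)" by (rule LeastI_ex)
  then have "a \<le> Least ?P" if "\<forall>k<a. \<not> ?P k"
    using that not_le by blast
  moreover have "\<not> ?P k" if "a \<le> Least ?P" "k < a" for k
    using that by (intro not_less_Least) simp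
  ultimately have "a \<le> Least ?P \<longleftrightarrow> (\<forall>k<a. \<not> ?P k)"
    by blast
  also have "\<dots> \<longleftrightarrow> (\<forall>k\<in>{1..a}. Poly_Mapping.lookup u (j, k) \<noteq> 0)"
  proof
    assume *: "\<forall>k<a. \<not> ?P k"
    show "\<forall>k\<in>{1..a}. Poly_Mapping.lookup u (j, k) \<noteq> 0"
    proof
      fix k assume "k \<in> {1..a}"
      then have "k = Suc (k - 1)" "k - 1 < a" by auto
      then show "Poly_Mapping.lookup u (j, k) \<noteq> 0" using * by metis
    qed
  qed auto
  finally show ?thesis by (simp add: lookup_depol)
qed

text \<open>The position \<open>(j, Suc (g j))\<close> lies outside the variable set, so every run
  stops there at the latest.\<close>

lemma lookup_depol_expos:
  assumes "u \<in> expos (pol_vars n g)"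
  shows "depol u \<in> expos {1..n}" "Poly_Mapping.lookup (depol u) j \<le> g j"
proof -
  have u: "Poly_Mapping.lookup u (i, k) = 0" if "i \<notin> {1..n} \<or> k \<notin> {1..g i}" for i k
    using assms that by (auto simp: expos_iff pol_vars_def)
  have "\<not> Suc (g j) \<le> Poly_Mapping.lookup (depol u) j"
    unfolding le_depol_iff using u[of j "Suc (g j)"] by (simp, intro bexI[of _ "Suc (g j)"]) simp_all
  then show "Poly_Mapping.lookup (depol u) j \<le> g j" by simp
  have "Poly_Mapping.lookup (depol u) i = 0" if "i \<notin> {1..n}" for i
  proof -
    have "\<not> 1 \<le> Poly_Mapping.lookup (depol u) i"
      unfolding le_depol_iff using u[of i 1] that by simp
    then show ?thesis by simp
  qed
  then show "depol u \<in> expos {1..n}"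
    unfolding expos_iff by blast
qed

text \<open>The link between the two rings. The polarized monomial is squarefree, so its
  divisibility into \<open>x^u\<close> only asks that the first \<open>t_j\<close> entries of each
  row be nonzero, which is a lower bound on the run.\<close>

lemma pol_expo_le_iff:
  assumes "t \<in> expos {1..n}"
  shows "(\<forall>x. Poly_Mapping.lookup (pol_expo n t) x \<le> Poly_Mapping.lookup u x) \<longleftrightarrow>
    (\<forall>j. Poly_Mapping.lookup t j \<le> Poly_Mapping.lookup (depol u) j)"
proof -
  have "(\<forall>x. Poly_Mapping.lookup (pol_expo n t) x \<le> Poly_Mapping.lookup u x) \<longleftrightarrow>
    (\<forall>j k. j \<in> {1..n} \<and> k \<in> {1..Poly_Mapping.lookup t j} \<longrightarrow> Poly_Mapping.lookup u (j, k) \<noteq> 0)"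
    by (auto simp: lookup_pol_expo Suc_le_eq)
  also have "\<dots> \<longleftrightarrow> (\<forall>j. Poly_Mapping.lookup t j \<le> Poly_Mapping.lookup (depol u) j)"
  proof -
    have "j \<in> {1..n}" if "k \<in> {1..Poly_Mapping.lookup t j}" for j k
      using assms that by (auto simp: expos_iff intro: ccontr)
    then show ?thesis
      unfolding le_depol_iff by blast
  qed
  finally show ?thesis .
qed

lemma pol_expo_expos:
  assumes "\<And>j. j \<in> {1..n} \<Longrightarrow> Poly_Mapping.lookup t j \<le> g j"
  shows "pol_expo n t \<in> expos (pol_vars n g)"
proof -
  have "Poly_Mapping.lookup (pol_expo n t) (j, k) = 0" if "(j, k) \<notin> pol_vars n g" for j k
    using that assms[of j] by (auto simp: lookup_pol_expo pol_vars_def)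
  then show ?thesis by (auto simp: expos_iff)
qed

text \<open>By \<open>pol_expo_le_iff\<close>, a polarized minimal generator divides
  \<open>x^u\<close> exactly when the original one divides the monomial of \<open>depol u\<close>.
  The polarized ideal is thus the preimage of \<open>T\<close> under \<open>depol\<close>.\<close>

lemma polarization_mspan:
  assumes T: "closed_expos {1..n} T" and bound: "pol_bound n g (mspan T :: (nat, 'k::field) mpol set)"
  shows "polarization n g (mspan T :: (nat, 'k) mpol set) = mspan {u \<in> expos (pol_vars n g). depol u \<in> T}"
    and "closed_expos (pol_vars n g) {u \<in> expos (pol_vars n g). depol u \<in> T}"
proof -
  let ?V = "pol_vars n g"
  let ?G = "min_gens (mspan T :: (nat, 'k) mpol set)"
  have G_T: "?G \<subseteq> T" by (rule min_gens_mspan)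
  have G_expos: "?G \<subseteq> expos {1..n}" using G_T T by (auto simp: closed_expos_def)
  have A: "pol_expo n ` ?G \<subseteq> expos ?V"
    using bound by (auto simp: pol_bound_def intro: pol_expo_expos)
  have eq: "(\<Union>a\<in>pol_expo n ` ?G. cone a ?V) = {u \<in> expos ?V. depol u \<in> T}"
  proof (rule Set.set_eqI)
    fix u
    show "u \<in> (\<Union>a\<in>pol_expo n ` ?G. cone a ?V) \<longleftrightarrow> u \<in> {u \<in> expos ?V. depol u \<in> T}"
    proof (cases "u \<in> expos ?V")
      case True
      have "u \<in> cone (pol_expo n t) ?V \<longleftrightarrow> (\<forall>j. Poly_Mapping.lookup t j \<le> Poly_Mapping.lookup (depol u) j)"
        if "t \<in> ?G" for t
      proof -
        have "pol_expo n t \<in> expos ?V" using A that by blast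
        then have "u \<in> cone (pol_expo n t) ?V \<longleftrightarrow>
          (\<forall>x. Poly_Mapping.lookup (pol_expo n t) x \<le> Poly_Mapping.lookup u x)"
          using True by (simp add: cone_def expos_iff)
        then show ?thesis using pol_expo_le_iff that G_expos by blast
      qed
      then have "u \<in> (\<Union>a\<in>pol_expo n ` ?G. cone a ?V) \<longleftrightarrow>
        (\<exists>t\<in>?G. \<forall>j. Poly_Mapping.lookup t j \<le> Poly_Mapping.lookup (depol u) j)"
        by blast
      also have "\<dots> \<longleftrightarrow> depol u \<in> T"
      proof
        assume "\<exists>t\<in>?G. \<forall>j. Poly_Mapping.lookup t j \<le> Poly_Mapping.lookup (depol u) j"
        then obtain t where "t \<in> T" "\<And>j. Poly_Mapping.lookup t j \<le> Poly_Mapping.lookup (depol u) j"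
          using G_T by blast
        then show "depol u \<in> T"
          using closed_expos_le[OF T _ lookup_depol_expos(1)[OF True]] by blast
      next
        assume "depol u \<in> T"
        then have "monom_of (depol u) \<in> (mspan T :: (nat, 'k) mpol set)" by (simp add: monom_of_mspan)
        then show "\<exists>t\<in>?G. \<forall>j. Poly_Mapping.lookup t j \<le> Poly_Mapping.lookup (depol u) j"
          by (rule ex_min_gens_le)
      qed
      finally show ?thesis using True by simp
    next
      case False
      have "u \<notin> cone a ?V" if "a \<in> pol_expo n ` ?G" for a
        using False cone_subset_expos[of a ?V ?V] A that by blast
      then show ?thesis using False by simp
    qed
  qed
  have "pol_mono n ` ?G = (monom_of ` pol_expo n ` ?G :: (nat \<times> nat, 'k) mpol set)"
    by (simp add: image_image pol_mono_eq)
  then show "polarization n g (mspan T :: (nat, 'k) mpol set) = mspan {u \<in> expos ?V. depol u \<in> T}"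
    unfolding polarization_def eq[symmetric] by (simp only: Idl_monoms[OF A])
  show "closed_expos ?V {u \<in> expos ?V. depol u \<in> T}"
    unfolding eq[symmetric] by (rule closed_expos_up[OF A])
qed

section \<open>Pulling cones back along \<open>depol\<close>\<close>

definition pol_cone :: "nat \<Rightarrow> (nat \<Rightarrow> nat) \<Rightarrow> nat expo \<times> nat set \<Rightarrow> (nat \<times> nat) expo \<times> (nat \<times> nat) set" where
  "pol_cone n g e = (pol_expo n (fst e),
     pol_vars n g - {(j, Suc (Poly_Mapping.lookup (fst e) j)) | j. j \<notin> snd e})"

text \<open>The lower bounds match by \<open>pol_expo_le_iff\<close>. Given them, a run has length
  exactly \<open>t_j\<close> iff the entry at \<open>(j, t_j + 1)\<close> is zero, whatever follows
  it; this is why only that variable is frozen for \<open>j\<close> outside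
  \<open>Z\<close>.\<close>

lemma mem_pol_cone_iff:
  assumes t: "t \<in> expos {1..n}" and u: "u \<in> expos (pol_vars n g)"
  shows "u \<in> cone (fst (pol_cone n g (t, Z))) (snd (pol_cone n g (t, Z))) \<longleftrightarrow> depol u \<in> cone t Z"
proof -
  have "(\<forall>x. x \<notin> snd (pol_cone n g (t, Z)) \<longrightarrow> Poly_Mapping.lookup u x = Poly_Mapping.lookup (pol_expo n t) x)
    \<longleftrightarrow> (\<forall>j. j \<notin> Z \<longrightarrow> Poly_Mapping.lookup (depol u) j = Poly_Mapping.lookup t j)" (is "?L \<longleftrightarrow> ?R")
    if le: "\<forall>x. Poly_Mapping.lookup (pol_expo n t) x \<le> Poly_Mapping.lookup u x"
      "\<forall>j. Poly_Mapping.lookup t j \<le> Poly_Mapping.lookup (depol u) j"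
  proof
    assume L: ?L
    show ?R
    proof (intro allI impI)
      fix j assume "j \<notin> Z"
      then have "(j, Suc (Poly_Mapping.lookup t j)) \<notin> snd (pol_cone n g (t, Z))"
        by (auto simp: pol_cone_def)
      with L have "Poly_Mapping.lookup u (j, Suc (Poly_Mapping.lookup t j)) =
        Poly_Mapping.lookup (pol_expo n t) (j, Suc (Poly_Mapping.lookup t j))" by blast
      then have "Poly_Mapping.lookup u (j, Suc (Poly_Mapping.lookup t j)) = 0"
        by (simp add: lookup_pol_expo)
      then have "\<not> Suc (Poly_Mapping.lookup t j) \<le> Poly_Mapping.lookup (depol u) j"
        unfolding le_depol_iff by (simp, intro bexI[of _ "Suc (Poly_Mapping.lookup t j)"]) simp_all
      then show "Poly_Mapping.lookup (depol u) j = Poly_Mapping.lookup t j"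
        using le(2) by (simp add: le_antisym not_less_eq_eq)
    qed
  next
    assume R: ?R
    show ?L
    proof (intro allI impI)
      fix x assume x: "x \<notin> snd (pol_cone n g (t, Z))"
      show "Poly_Mapping.lookup u x = Poly_Mapping.lookup (pol_expo n t) x"
      proof (cases "x \<in> pol_vars n g")
        case True
        then obtain j where j: "x = (j, Suc (Poly_Mapping.lookup t j))" "j \<notin> Z"
          using x by (auto simp: pol_cone_def)
        have "\<not> Suc (Poly_Mapping.lookup t j) \<le> Poly_Mapping.lookup (depol u) j"
          using R j(2) by simp
        then obtain k where k: "k \<in> {1..Suc (Poly_Mapping.lookup t j)}" "Poly_Mapping.lookup u (j, k) = 0"
          unfolding le_depol_iff by blast
        have "\<forall>k\<in>{1..Poly_Mapping.lookup t j}. Poly_Mapping.lookup u (j, k) \<noteq> 0"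
          using le(2) le_depol_iff by blast
        \<comment> \<open>The first \<open>t_j\<close> entries are nonzero, so the zero that ends
          the run can only sit at position \<open>t_j + 1\<close>.\<close>
        with k have "k = Suc (Poly_Mapping.lookup t j)"
          by (metis atLeastAtMost_iff le_Suc_eq)
        then show ?thesis using k(2) j(1) by (simp add: lookup_pol_expo)
      next
        case False
        \<comment> \<open>Outside the variable set \<open>u\<close> vanishes, and the smaller
          exponent \<open>pol_expo n t\<close> vanishes with it.\<close>
        then have "Poly_Mapping.lookup u x = 0" using u unfolding expos_iff by blast
        then show ?thesis using le(1) by (metis le_zero_eq)
      qed
    qed
  qed
  then show ?thesis
    using pol_expo_le_iff[OF t, of u] unfolding cone_def by (auto simp: pol_cone_def)
qed

text \<open>Preimages of the blocks of a partition again form a partition, and by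
  \<open>mem_pol_cone_iff\<close> each preimage is empty or a cone.\<close>

lemma cone_partition_polarization:
  assumes A: "A \<subseteq> expos {1..n}" and E: "cone_partition {1..n} A E"
  shows "\<exists>E'. cone_partition (pol_vars n g) {u \<in> expos (pol_vars n g). depol u \<in> A} E' \<and> card E' \<le> card E"
proof -
  let ?V = "pol_vars n g"
  \<comment> \<open>Values of \<open>depol\<close> are bounded by \<open>g\<close>, so cones whose
    apex exceeds \<open>g\<close> have empty preimage and are left out; for the others the polarized
    apex lies in the right ring.\<close>
  define E0 where "E0 = {e \<in> E. \<forall>j\<in>{1..n}. Poly_Mapping.lookup (fst e) j \<le> g j}"
  have "finite E" using E by (simp add: cone_partition_def)
  then have fin: "finite E0" and card: "card E0 \<le> card E"
    by (simp_all add: E0_def card_mono)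
  have e: "fst e \<in> expos {1..n}" "cone (fst e) (snd e) \<subseteq> A" if "e \<in> E" for e
  proof -
    show *: "cone (fst e) (snd e) \<subseteq> A"
      using E that by (auto simp: cone_partition_def split_beta)
    show "fst e \<in> expos {1..n}" using * A cone_self by blast
  qed
  have mem: "u \<in> cone (fst (pol_cone n g e)) (snd (pol_cone n g e)) \<longleftrightarrow> depol u \<in> cone (fst e) (snd e)"
    if "e \<in> E" "u \<in> expos ?V" for e u
    using mem_pol_cone_iff[OF e(1)[OF that(1)] that(2), of "snd e"] by simp
  have "cone_partition ?V {u \<in> expos ?V. depol u \<in> A} (pol_cone n g ` E0)"
    unfolding cone_partition_def
  proof (intro conjI ballI)
    show "finite (pol_cone n g ` E0)" using fin by simp
  next
    fix e' assume "e' \<in> pol_cone n g ` E0"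
    then obtain f where f: "f \<in> E0" "e' = pol_cone n g f" by blast
    then have fE: "f \<in> E" by (simp add: E0_def)
    have "fst e' \<in> expos ?V"
      unfolding f(2) pol_cone_def fst_conv by (rule pol_expo_expos) (use f(1) in \<open>simp add: E0_def\<close>)
    moreover have Z: "snd e' \<subseteq> ?V" by (auto simp: f(2) pol_cone_def)
    ultimately have sub: "cone (fst e') (snd e') \<subseteq> expos ?V"
      by (rule cone_subset_expos)
    then have "cone (fst e') (snd e') \<subseteq> {u \<in> expos ?V. depol u \<in> A}"
      using mem[OF fE] e(2)[OF fE] f(2) by blast
    then show "case e' of (t, Z) \<Rightarrow> Z \<subseteq> ?V \<and> cone t Z \<subseteq> {u \<in> expos ?V. depol u \<in> A}"
      using Z by (simp add: split_beta)
  next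
    fix u assume "u \<in> {u \<in> expos ?V. depol u \<in> A}"
    then have u: "u \<in> expos ?V" "depol u \<in> A" by auto
    then have "\<exists>!e. e \<in> E \<and> depol u \<in> cone (fst e) (snd e)"
      using E by (simp add: cone_partition_def)
    then obtain f where f: "f \<in> E \<and> depol u \<in> cone (fst f) (snd f)"
      and uniq: "\<forall>e. e \<in> E \<and> depol u \<in> cone (fst e) (snd e) \<longrightarrow> e = f"
      by (rule ex1E)
    have "f \<in> E0"
    proof -
      have "Poly_Mapping.lookup (fst f) j \<le> g j" for j
        using f lookup_depol_expos(2)[OF u(1), of j] unfolding cone_def by (auto intro: le_trans)
      then show ?thesis using f by (simp add: E0_def)
    qed
    show "\<exists>!e'. e' \<in> pol_cone n g ` E0 \<and> u \<in> cone (fst e') (snd e')"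
    proof (rule ex1I[of _ "pol_cone n g f"])
      show "pol_cone n g f \<in> pol_cone n g ` E0 \<and> u \<in> cone (fst (pol_cone n g f)) (snd (pol_cone n g f))"
        using \<open>f \<in> E0\<close> mem[of f u] f u(1) by blast
    next
      fix e' assume e': "e' \<in> pol_cone n g ` E0 \<and> u \<in> cone (fst e') (snd e')"
      then obtain h where h: "h \<in> E0" "e' = pol_cone n g h" by blast
      then have "h \<in> E" by (simp add: E0_def)
      moreover from this have "depol u \<in> cone (fst h) (snd h)"
        using mem[of h u] e' h(2) u(1) by simp
      ultimately have "h = f" by (intro uniq[rule_format] conjI)
      then show "e' = pol_cone n g f" using h(2) by blast
    qed
  qed
  moreover have "card (pol_cone n g ` E0) \<le> card E"
    using card_image_le[OF fin, of "pol_cone n g"] card by linarith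
  ultimately show ?thesis by blast
qed

section \<open>Comparison of the two Stanley lengths\<close>

theorem theorem2p14:
  fixes n :: nat and g :: "nat \<Rightarrow> nat" and I J :: "(nat, 'k::field) mpol set"
  assumes "monomial_ideal {1..n} I" and "monomial_ideal {1..n} J"
    and "I \<subset> J"
    and "pol_bound n g I" and "pol_bound n g J"
  shows "slength {1..n} (quot_module {1..n} J I) \<ge>
    slength (pol_vars n g)
      (quot_module (pol_vars n g) (polarization n g J) (polarization n g I))"
proof -
  obtain TI where TI: "closed_expos {1..n} TI" "I = mspan TI"
    using assms(1) by (rule monomial_idealE)
  obtain TJ where TJ: "closed_expos {1..n} TJ" "J = mspan TJ"
    using assms(2) by (rule monomial_idealE)
  let ?V = "pol_vars n g"
  let ?P = "\<lambda>T. {u \<in> expos ?V. depol u \<in> T}"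
  have bound: "pol_bound n g (mspan TI :: (nat, 'k) mpol set)" "pol_bound n g (mspan TJ :: (nat, 'k) mpol set)"
    using assms(4,5) by (simp_all add: TI(2) TJ(2))
  interpret Q: monomial_quotient "{1..n}" TI TJ I J
    by unfold_locales (use TI TJ in simp_all)
  interpret P: monomial_quotient ?V "?P TI" "?P TJ" "polarization n g I" "polarization n g J"
  proof
    show "closed_expos ?V (?P TI)" "closed_expos ?V (?P TJ)"
      using polarization_mspan(2)[OF TI(1) bound(1)] polarization_mspan(2)[OF TJ(1) bound(2)] .
    show "polarization n g I = mspan (?P TI)" "polarization n g J = mspan (?P TJ)"
      unfolding TI(2) TJ(2)
      using polarization_mspan(1)[OF TI(1) bound(1)] polarization_mspan(1)[OF TJ(1) bound(2)] .
  qed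
  have A: "TJ - TI \<subseteq> expos {1..n}" using Q.TJ_sub by blast
  \<comment> \<open>Some decomposition must be exhibited first, so that the minimum defining the
    length of \<open>J/I\<close> is attained by an actual \<open>D\<close>.\<close>
  have "\<exists>E. cone_partition {1..n} (TJ - TI) E"
  proof (rule ex_cone_partition[OF _ A])
    fix u :: "nat expo" assume "u \<in> expos {1..n}"
    then show "cap g u \<in> TJ - TI \<longleftrightarrow> u \<in> TJ - TI"
      using cap_mem_iff[OF TI(1) bound(1)] cap_mem_iff[OF TJ(1) bound(2)] by simp
  qed simp
  then have "\<exists>r D. stanley_decomposition {1..n} Q.M D \<and> length D = r"
    using Q.stanley_decomposition_of_cone_partition by blast
  then have "\<exists>D. stanley_decomposition {1..n} Q.M D \<and> length D = slength {1..n} Q.M"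
    unfolding slength_def by (rule LeastI_ex)
  then obtain D where D: "stanley_decomposition {1..n} Q.M D" "length D = slength {1..n} Q.M"
    by blast
  obtain E where E: "cone_partition {1..n} (TJ - TI) E" "card E \<le> length D"
    using Q.cone_partition_of_stanley_decomposition[OF D(1)] by blast
  obtain E' where E': "cone_partition ?V (?P (TJ - TI)) E'" "card E' \<le> card E"
    using cone_partition_polarization[OF A E(1)] by blast
  have "?P (TJ - TI) = ?P TJ - ?P TI" by blast
  with E'(1) have "cone_partition ?V (?P TJ - ?P TI) E'" by (simp only:)
  from P.stanley_decomposition_of_cone_partition[OF this]
  obtain D' where D': "stanley_decomposition ?V P.M D'" "length D' = card E'"
    by blast
  \<comment> \<open>For the polarized quotient any decomposition bounds the minimum from above; the
    rest is the chain from \<open>D'\<close> through \<open>E'\<close> and \<open>E\<close> to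
    \<open>D\<close>.\<close>
  have "slength ?V P.M \<le> length D'"
    unfolding slength_def by (rule Least_le) (use D'(1) in blast)
  then show ?thesis
    using D'(2) E'(2) E(2) D(2) by linarith
qed

end
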